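(* Let $K\subseteq\mathbb R^n$ be a Lebesgue measurable set such that for some unit vector $e\in S^{n-1}$ the following holds: whenever $x\in e^\perp$, $t\in\mathbb R$ and $x+te\in K$, also $-x+te\in K$. Let $T:\mathcal P(\mathbb R^n)\to\mathcal P(\mathbb R^n)$ be given by $TK=\{x\in\mathbb R^n:\ \langle x,y\rangle\ge 1\ \forall y\in K\}$. Then \[ \gamma_n(K)\,\gamma_n(TK)\le\gamma_n(K_0)^2, \] where $K_0=\{(x,t)\in\mathbb R^{n-1}\times\mathbb R^+:\ |x|^2+1\le t^2\}$.
   Context: $\gamma_n$ denotes the standard Gaussian probability measure on $\mathbb R^n$, $|\cdot|$ the Euclidean norm, $\langle\cdot,\cdot\rangle$ the standard inner product, $S^{n-1}$ the Euclidean unit sphere, and $\mathbb R^+=[0,\infty)$. *)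

theory Defs
  imports "HOL-Analysis.Analysis"
begin

definition gaussian_measure :: "'a::euclidean_space measure" where
  "gaussian_measure = density lebesgue
     (\<lambda>x. ennreal ((2 * pi) powr (- real DIM('a) / 2) * exp (- (norm x)\<^sup>2 / 2)))"

definition T_op :: "'a::euclidean_space set \<Rightarrow> 'a set" where
  "T_op K = {x. \<forall>y\<in>K. x \<bullet> y \<ge> 1}"

definition last_basis :: "'a::euclidean_space" where
  "last_basis = (SOME b. b \<in> Basis)"

definition K0 :: "'a::euclidean_space set" where
  "K0 = {z. let t = z \<bullet> last_basis; x = z - t *\<^sub>R last_basis in
            t \<ge> 0 \<and> (norm x)\<^sup>2 + 1 \<le> t\<^sup>2}"

end

theory Submission
  imports Defs "HOL-Probability.Distributions"
begin

text \<open>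
  The set \<open>K\<close> may be replaced by the closed set \<open>T (T K)\<close>, which has the same reflection symmetry.
  By this symmetry, points \<open>x + s e\<close> of \<open>K\<close> and \<open>y + t e\<close> of \<open>T K\<close> satisfy
  \<open>|\<langle>x, y\<rangle>| \<le> s t - 1\<close>, and \<open>s\<close>, \<open>t\<close> have a constant common sign. So the slices of \<open>K\<close> and \<open>T K\<close> are, up to
  the factor \<open>s t - 1\<close>, polar to each other, the Gaussian Blaschke--Santalo inequality bounds the product of
  their measures by the square of the measure of the slice of \<open>K\<^sub>0\<close> at height \<open>\<surd>(s t)\<close>, and the
  multiplicative Prekopa--Leindler inequality integrates this over the heights.

  The Gaussian Blaschke--Santalo inequality follows from the Lebesgue one by the same argument, with
  slices replaced by intersections with balls. The Lebesgue one follows from the functional Santalo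
  inequality, which is proved by Lehec's induction on the dimension: cut one function into two halves of
  equal mass by a hyperplane, shear along the line through the two barycenters, and integrate out the
  transversal variable on both sides of the hyperplane.
\<close>

section \<open>The one-dimensional Prekopa--Leindler inequality\<close>

text \<open>Prekopa--Leindler on the half-line is used four times (for half-lines, dilates, balls
  and slices). Each time the constraint between two pieces involves their parameters
  \<open>s\<close> and \<open>t\<close> only through \<open>s * t\<close>, and any weight satisfies
  \<open>W s * W t \<le> (W (sqrt (s * t)))^2\<close>; this is why geometric means of heights appear
  throughout.

  In the functional Santalo inequality the obstacle is that cutting by a hyperplane destroys
  symmetry. The induction therefore assumes only that one of the two functions is centered, and the
  functions exchange roles at every step: the centering of \<open>f\<close> pays for translating the
  cut of \<open>g\<close> through the origin, and the shear makes the marginals of the halves of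
  \<open>g\<close> centered one dimension lower. Evenness serves only to verify centering when the
  result is applied.

  A Lebesgue measurable \<open>K\<close> may have non-measurable slices, whereas
  \<open>T (T K)\<close> and \<open>T K\<close> are closed, so that every later set is Borel. The
  axis \<open>e\<close> is arbitrary but \<open>K0\<close> is built on a basis vector; the two
  hyperboloids are compared slice by slice through integrals of radial functions, so that no
  rotation enters.\<close>

lemma emeasure_lborel_shift:
  fixes A :: "real set"
  assumes "A \<in> sets borel"
  shows "emeasure lborel ((+) c ` A) = emeasure lborel A"
proof -
  have [measurable]: "A \<in> sets borel" by fact
  have "(+) c ` A = (\<lambda>x. (-c) + x) -` A"
    by (auto simp: image_iff intro!: bexI[where x="_ - c"])
  then have "emeasure lborel ((+) c ` A) = emeasure (distr lborel borel ((+) (-c))) A"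
    by (simp add: emeasure_distr del: uminus_add_conv_diff)
  then show ?thesis
    using lborel_distr_plus[of "-c"] by simp
qed

text \<open>With \<open>a\<close> the largest point of \<open>A\<close> and \<open>b\<close> the
  smallest point of \<open>B\<close>, the translates \<open>b + A\<close> and \<open>a + B\<close>
  both lie in \<open>C\<close> and meet only at \<open>a + b\<close>, so their measures add
  up.\<close>

lemma brunn_minkowski_compact:
  fixes A B C :: "real set"
  assumes A: "compact A" "A \<noteq> {}" and B: "compact B" "B \<noteq> {}"
    and C[measurable]: "C \<in> sets borel" and sub: "\<And>a b. a \<in> A \<Longrightarrow> b \<in> B \<Longrightarrow> a + b \<in> C"
  shows "emeasure lborel A + emeasure lborel B \<le> emeasure lborel C"
proof -
  have [measurable]: "A \<in> sets borel" "B \<in> sets borel"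
    using A B by (auto intro: borel_compact)
  obtain a where a: "a \<in> A" "\<And>x. x \<in> A \<Longrightarrow> x \<le> a"
    using compact_attains_sup[OF A] by blast
  obtain b where b: "b \<in> B" "\<And>x. x \<in> B \<Longrightarrow> b \<le> x"
    using compact_attains_inf[OF B] by blast
  have m: "(+) b ` A \<in> sets borel" "(+) a ` B \<in> sets borel"
    using A B by (auto intro!: borel_compact compact_translation)
  have "emeasure lborel A + emeasure lborel B = emeasure lborel ((+) b ` A) + emeasure lborel ((+) a ` B)"
    by (simp add: emeasure_lborel_shift)
  also have "emeasure lborel ((+) a ` B) = emeasure lborel ((+) a ` B - {a + b})"
    using m by (intro emeasure_Diff_null_set[symmetric]) auto
  also have "emeasure lborel ((+) b ` A) + \<dots> = emeasure lborel ((+) b ` A \<union> ((+) a ` B - {a + b}))"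
  proof (rule plus_emeasure)
    have "b + x \<noteq> a + y" if "x \<in> A" "y \<in> B" "y \<noteq> b" for x y
      using a(2)[OF that(1)] b(2)[OF that(2)] that(3) by auto
    then show "(+) b ` A \<inter> ((+) a ` B - {a + b}) = {}"
      by auto
  qed (use m in auto)
  also have "\<dots> \<le> emeasure lborel C"
  proof (rule emeasure_mono)
    show "(+) b ` A \<union> ((+) a ` B - {a + b}) \<subseteq> C"
      using sub a(1) b(1) by (auto simp: add.commute[of b])
  qed simp
  finally show ?thesis .
qed

text \<open>Inner regularity in two stages, which also covers sets of infinite measure: a closed
  subset missing only measure \<open>e\<close>, then its intersection with large balls.\<close>

lemma borel_approx_compact:
  fixes A :: "real set"
  assumes "A \<in> sets borel" "A \<noteq> {}" "r < emeasure lborel A"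
  obtains T where "compact T" "T \<noteq> {}" "T \<subseteq> A" "r < emeasure lborel T"
proof -
  obtain e :: real where e: "0 < e" "r + e < emeasure lborel A"
  proof -
    obtain q where q: "r < q" "q < emeasure lborel A"
      using assms(3) dense by blast
    then obtain r' q' where r': "r = ennreal r'" "0 \<le> r'" "q = ennreal q'" "0 \<le> q'" "r' < q'"
      by (metis ennreal_cases ennreal_less_iff less_top_ennreal linorder_neq_iff order_less_imp_not_less top_neq_ennreal)
    show ?thesis
      by (rule that[of "q' - r'"]) (use r' q in \<open>auto simp flip: ennreal_plus\<close>)
  qed
  obtain S where S: "closed S" "S \<subseteq> A" "A - S \<in> lmeasurable" "emeasure lebesgue (A - S) < ennreal e"
    using sets_lebesgue_inner_closed[of A e] assms e by auto
  have [measurable]: "S \<in> sets borel" "A \<in> sets borel"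
    using S assms by auto
  have "emeasure lborel A \<le> emeasure lborel (S \<union> (A - S))"
    by (intro emeasure_mono) auto
  also have "\<dots> \<le> emeasure lborel S + emeasure lborel (A - S)"
    by (intro emeasure_subadditive) auto
  also have "\<dots> \<le> emeasure lborel S + e"
    using S(4) by (intro add_left_mono) auto
  finally have "r < emeasure lborel S"
    using e(2) by (metis add_right_mono leD leI order_trans)
  also have "emeasure lborel S = (SUP n. emeasure lborel (S \<inter> cball 0 (real n)))"
  proof (subst SUP_emeasure_incseq)
    show "incseq (\<lambda>n. S \<inter> cball 0 (real n))"
      by (auto simp: incseq_def)
    have "S = (\<Union>n. S \<inter> cball 0 (real n))"
      using real_arch_simple by (auto simp: cball_def)
    then show "emeasure lborel S = emeasure lborel (\<Union>n. S \<inter> cball 0 (real n))"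
      by simp
  qed auto
  finally obtain n where n: "r < emeasure lborel (S \<inter> cball 0 (real n))"
    by (auto simp: less_SUP_iff)
  show ?thesis
  proof (rule that[OF _ _ _ n])
    show "compact (S \<inter> cball 0 (real n))"
      using S by (intro closed_Int_compact) auto
    show "S \<inter> cball 0 (real n) \<noteq> {}"
      using n by (metis emeasure_empty not_less_zero)
  qed (use S in auto)
qed

lemma brunn_minkowski_real:
  fixes A B C :: "real set"
  assumes A: "A \<in> sets borel" "A \<noteq> {}" and B: "B \<in> sets borel" "B \<noteq> {}"
    and C[measurable]: "C \<in> sets borel" and sub: "\<And>a b. a \<in> A \<Longrightarrow> b \<in> B \<Longrightarrow> a + b \<in> C"
  shows "emeasure lborel A + emeasure lborel B \<le> emeasure lborel C"
proof -
  \<comment> \<open>The alternative \<open>r = 0\<close> covers null sets: they must still supply a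
    nonempty compact set, for which a single point suffices.\<close>
  have app: "\<exists>T. compact T \<and> T \<noteq> {} \<and> T \<subseteq> X \<and> (r < emeasure lborel T \<or> r = 0)"
    if "X \<in> sets borel" "X \<noteq> {}" "r < emeasure lborel X \<or> r = 0" for X :: "real set" and r
  proof (cases "r < emeasure lborel X")
    case True
    then show ?thesis using borel_approx_compact[OF that(1,2)] by metis
  next
    case False
    obtain x where "x \<in> X" using \<open>X \<noteq> {}\<close> by blast
    with False that show ?thesis by (intro exI[of _ "{x}"]) auto
  qed
  have key: "r + s \<le> emeasure lborel C"
    if r: "r < emeasure lborel A \<or> r = 0" and s: "s < emeasure lborel B \<or> s = 0" for r s
  proof -
    obtain T where T: "compact T" "T \<noteq> {}" "T \<subseteq> A" "r < emeasure lborel T \<or> r = 0"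
      using app[OF A r] by blast
    obtain U where U: "compact U" "U \<noteq> {}" "U \<subseteq> B" "s < emeasure lborel U \<or> s = 0"
      using app[OF B s] by blast
    have "r + s \<le> emeasure lborel T + emeasure lborel U"
      using T U by (intro add_mono) auto
    also have "\<dots> \<le> emeasure lborel C"
      using T U sub by (intro brunn_minkowski_compact) auto
    finally show ?thesis .
  qed
  \<comment> \<open>Adding 0 to the index set keeps it nonempty when \<open>x = 0\<close>, as is
    needed to move sums through suprema.\<close>
  have sup: "x = Sup {r. r < x \<or> r = 0}" for x :: ennreal
  proof (rule antisym)
    show "x \<le> Sup {r. r < x \<or> r = 0}"
      by (rule dense_le) (auto intro: Sup_upper)
    show "Sup {r. r < x \<or> r = 0} \<le> x"
      by (rule Sup_least) auto
  qed
  let ?R = "\<lambda>x :: ennreal. {r. r < x \<or> r = 0}"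
  have 1: "emeasure lborel A + s \<le> emeasure lborel C" if "s \<in> ?R (emeasure lborel B)" for s
  proof -
    have "Sup (?R (emeasure lborel A)) + s = (SUP r\<in>?R (emeasure lborel A). r + s)"
      using ennreal_SUP_add_left[of "?R (emeasure lborel A)" "\<lambda>x. x" s]
      by force
    also have "\<dots> \<le> emeasure lborel C"
      using key that by (intro SUP_least) auto
    finally show ?thesis using sup by metis
  qed
  have "emeasure lborel A + Sup (?R (emeasure lborel B)) = (SUP s\<in>?R (emeasure lborel B). emeasure lborel A + s)"
    using ennreal_SUP_add_right[of "?R (emeasure lborel B)" "emeasure lborel A" "\<lambda>x. x"]
    by force
  also have "\<dots> \<le> emeasure lborel C"
    using 1 by (intro SUP_least) auto
  finally show ?thesis using sup by metis
qed

section \<open>From level sets to functions\<close>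

lemma nn_integral_indicator_below:
  assumes "0 \<le> x"
  shows "(\<integral>\<^sup>+h. indicator {0<..<1} h * indicator {h. ennreal h < ennreal x} h \<partial>lborel) = ennreal (min x 1)"
proof -
  have "(\<integral>\<^sup>+h. indicator {0<..<1} h * indicator {h. ennreal h < ennreal x} h \<partial>lborel)
    = (\<integral>\<^sup>+h. indicator {0<..<min x 1} h \<partial>lborel)"
    using assms by (intro nn_integral_cong) (auto simp: indicator_def ennreal_less_iff)
  then show ?thesis using assms by simp
qed

text \<open>Truncation at 1 restricts the layer-cake formula to heights below 1. Functions with
  supremum 1 lose nothing, and for the upper function the truncation only lowers an upper
  bound.\<close>

lemma layer_cake_unit:
  fixes f :: "real \<Rightarrow> ennreal"
  assumes [measurable]: "f \<in> borel_measurable borel"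
  shows "(\<integral>\<^sup>+x. min (f x) 1 \<partial>lborel) = (\<integral>\<^sup>+h. indicator {0<..<1} h * emeasure lborel {x. ennreal h < f x} \<partial>lborel)"
proof -
  have *: "min (f x) 1 = (\<integral>\<^sup>+h. indicator {0<..<1} h * indicator {h. ennreal h < f x} h \<partial>lborel)" for x
  proof (cases "f x")
    case (real r)
    then show ?thesis
      using nn_integral_indicator_below[of r] by (simp add: min_def flip: ennreal_1 split: if_splits)
  next
    case top
    then have "(\<integral>\<^sup>+h. indicator {0<..<1} h * indicator {h. ennreal h < f x} h \<partial>lborel)
      = (\<integral>\<^sup>+h. indicator {0<..<1::real} h \<partial>lborel)"
      by (intro nn_integral_cong) (auto simp: indicator_def)
    then show ?thesis using top by simp
  qed
  have "(\<integral>\<^sup>+x. min (f x) 1 \<partial>lborel)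
    = (\<integral>\<^sup>+x. (\<integral>\<^sup>+h. indicator {0<..<1} h * indicator {h. ennreal h < f x} h \<partial>lborel) \<partial>lborel)"
    by (simp add: *)
  also have "\<dots> = (\<integral>\<^sup>+h. (\<integral>\<^sup>+x. indicator {0<..<1} h * indicator {h. ennreal h < f x} h \<partial>lborel) \<partial>lborel)"
    by (intro lborel_pair.Fubini') (simp add: indicator_def)
  also have "\<dots> = (\<integral>\<^sup>+h. indicator {0<..<1} h * emeasure lborel {x. ennreal h < f x} \<partial>lborel)"
  proof (intro nn_integral_cong)
    fix h :: real
    have "(\<integral>\<^sup>+x. indicator {0<..<1} h * indicator {h. ennreal h < f x} h \<partial>lborel)
      = (\<integral>\<^sup>+x. indicator {0<..<1} h * indicator {x. ennreal h < f x} x \<partial>lborel)"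
      by (intro nn_integral_cong) (auto simp: indicator_def)
    then show "(\<integral>\<^sup>+x. indicator {0<..<1} h * indicator {h. ennreal h < f x} h \<partial>lborel)
      = indicator {0<..<1} h * emeasure lborel {x. ennreal h < f x}"
      by (simp add: nn_integral_cmult)
  qed
  finally show ?thesis .
qed

lemma emeasure_lborel_scale2:
  fixes A :: "real set"
  assumes [measurable]: "A \<in> sets borel"
  shows "emeasure lborel {z. z / 2 \<in> A} = 2 * emeasure lborel A"
proof -
  have "emeasure lborel A = (\<integral>\<^sup>+x. indicator A x \<partial>lborel)" by simp
  also have "\<dots> = ennreal \<bar>1/2\<bar> * (\<integral>\<^sup>+x. indicator A (0 + (1/2) * x) \<partial>lborel)"
    by (rule nn_integral_real_affine) auto
  also have "(\<integral>\<^sup>+x. indicator A (0 + (1/2) * x) \<partial>lborel) = (\<integral>\<^sup>+x. indicator {z. z / 2 \<in> A} x \<partial>lborel)"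
    by (intro nn_integral_cong) (auto simp: indicator_def)
  also have "\<dots> = emeasure lborel {z. z / 2 \<in> A}" by simp
  finally have "2 * emeasure lborel A = (2 * ennreal (1/2)) * emeasure lborel {z. z / 2 \<in> A}"
    by (simp add: mult.assoc)
  also have "2 * ennreal (1/2) = 1"
    by (metis ennreal_1 ennreal_mult' ennreal_numeral nonzero_mult_div_cancel_left times_divide_eq_right zero_le_numeral zero_neq_numeral mult.commute mult.right_neutral)
  finally show ?thesis by simp
qed

lemma ennreal_amgm: "4 * (p * q) \<le> (p + q :: ennreal)\<^sup>2"
proof (cases "p = \<infinity> \<or> q = \<infinity>")
  case True
  then show ?thesis by (auto simp: power2_eq_square ennreal_mult_eq_top_iff)
next
  case False
  then obtain a b where ab: "p = ennreal a" "0 \<le> a" "q = ennreal b" "0 \<le> b"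
    by (metis ennreal_cases infinity_ennreal_def)
  have "4 * (a * b) \<le> (a + b)\<^sup>2"
    using zero_le_power2[of "a - b"] by (simp add: power2_eq_square algebra_simps)
  then have "ennreal (4 * (a * b)) \<le> ennreal ((a+b)\<^sup>2)"
    by (rule ennreal_leI)
  then show ?thesis
    using ab by (simp add: ennreal_mult' ennreal_power flip: ennreal_plus)
qed

lemma ennreal_square_le_iff: "x * x \<le> y * y \<Longrightarrow> x \<le> (y::ennreal)"
proof (rule ccontr)
  assume *: "x * x \<le> y * y" "\<not> x \<le> y"
  then have "y < x" by simp
  then obtain b where b: "y = ennreal b" "0 \<le> b"
    by (metis ennreal_cases not_top_less)
  have "y * y < x * x"
  proof (cases x)
    case (real a)
    with \<open>y < x\<close> b have "b * b < a * a"
      by (intro mult_strict_mono) (auto simp: ennreal_less_iff intro: le_less_trans)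
    then show ?thesis
      using real b by (simp add: ennreal_less_iff flip: ennreal_mult)
  qed (simp add: b ennreal_mult_less_top flip: ennreal_mult)
  with * show False by simp
qed

text \<open>Both suprema being equal to 1, the level sets of \<open>f\<close> and \<open>g\<close> are nonempty at the same
  heights, so that the one-dimensional Brunn--Minkowski inequality applies to each of them.\<close>

lemma prekopa_leindler_normalized:
  fixes f g k :: "real \<Rightarrow> ennreal"
  assumes [measurable]: "f \<in> borel_measurable borel" "g \<in> borel_measurable borel" "k \<in> borel_measurable borel"
    and f: "(SUP x. f x) = 1" and g: "(SUP x. g x) = 1"
    and le: "\<And>x y. f x * g y \<le> (k ((x + y) / 2))\<^sup>2"
  shows "(\<integral>\<^sup>+x. f x \<partial>lborel) + (\<integral>\<^sup>+x. g x \<partial>lborel) \<le> 2 * (\<integral>\<^sup>+x. k x \<partial>lborel)"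
proof -
  let ?e = "emeasure lborel"
  have level: "?e {x. ennreal h < f x} + ?e {x. ennreal h < g x} \<le> 2 * ?e {x. ennreal h < k x}"
    if "0 < h" "h < 1" for h
  proof -
    have "?e {x. ennreal h < f x} + ?e {x. ennreal h < g x} \<le> ?e {z. z / 2 \<in> {x. ennreal h < k x}}"
    proof (rule brunn_minkowski_real)
      have "ennreal h < 1"
        using that by (simp flip: ennreal_1 add: ennreal_less_iff)
      then show "{x. ennreal h < f x} \<noteq> {}" "{x. ennreal h < g x} \<noteq> {}"
        using f g by (metis (mono_tags, lifting) Collect_empty_eq less_SUP_iff)+
      fix a b assume "a \<in> {x. ennreal h < f x}" "b \<in> {x. ennreal h < g x}"
      then have "ennreal h < f a" "ennreal h < g b" by auto
      \<comment> \<open>The hypothesis bounds the geometric mean of the two values, which dominates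
        their minimum.\<close>
      then have "ennreal h < min (f a) (g b)" by auto
      also have "\<dots> \<le> k ((a + b) / 2)"
      proof (rule ennreal_square_le_iff)
        have "min (f a) (g b) * min (f a) (g b) \<le> f a * g b"
          by (intro mult_mono) auto
        also note le
        finally show "min (f a) (g b) * min (f a) (g b) \<le> k ((a + b) / 2) * k ((a + b) / 2)"
          by (simp add: power2_eq_square)
      qed
      finally show "a + b \<in> {z. z / 2 \<in> {x. ennreal h < k x}}" by simp
    qed measurable
    also have "\<dots> = 2 * ?e {x. ennreal h < k x}"
      by (rule emeasure_lborel_scale2) measurable
    finally show ?thesis .
  qed
  have [measurable]: "(\<lambda>h. ?e {x. ennreal h < F x}) \<in> borel_measurable borel"
    if [measurable]: "F \<in> borel_measurable borel" for F :: "real \<Rightarrow> ennreal"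
  proof -
    have "(\<lambda>h. emeasure lborel (Pair h -` {p \<in> space (lborel \<Otimes>\<^sub>M lborel). ennreal (fst p) < F (snd p)})) \<in> borel_measurable lborel"
      by (rule lborel.measurable_emeasure_Pair) measurable
    then show ?thesis by (simp add: space_pair_measure vimage_def)
  qed
  have min1: "min (f x) 1 = f x" "min (g x) 1 = g x" for x
    using SUP_upper[of x UNIV f] SUP_upper[of x UNIV g] f g by (auto simp: min_def)
  have "(\<integral>\<^sup>+x. f x \<partial>lborel) + (\<integral>\<^sup>+x. g x \<partial>lborel)
    = (\<integral>\<^sup>+h. indicator {0<..<1} h * ?e {x. ennreal h < f x} + indicator {0<..<1} h * ?e {x. ennreal h < g x} \<partial>lborel)"
    using layer_cake_unit[of f] layer_cake_unit[of g]
    by (simp add: min1 nn_integral_add)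
  also have "\<dots> \<le> (\<integral>\<^sup>+h. 2 * (indicator {0<..<1} h * ?e {x. ennreal h < k x}) \<partial>lborel)"
    using level by (intro nn_integral_mono) (auto simp: indicator_def)
  also have "\<dots> = 2 * (\<integral>\<^sup>+x. min (k x) 1 \<partial>lborel)"
    by (subst nn_integral_cmult) (simp_all add: layer_cake_unit)
  also have "\<dots> \<le> 2 * (\<integral>\<^sup>+x. k x \<partial>lborel)"
    by (intro mult_left_mono nn_integral_mono) auto
  finally show ?thesis .
qed

text \<open>Dividing by the suprema reduces to the normalized case. That case bounds a sum of
  integrals, and AM-GM turns the sum into a product, after which the normalizing factors
  cancel.\<close>

lemma prekopa_leindler_bounded:
  fixes f g h :: "real \<Rightarrow> ennreal"
  assumes [measurable]: "f \<in> borel_measurable borel" "g \<in> borel_measurable borel" "h \<in> borel_measurable borel"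
    and bd: "(SUP x. f x) < \<infinity>" "(SUP x. g x) < \<infinity>"
    and le: "\<And>x y. f x * g y \<le> (h ((x + y) / 2))\<^sup>2"
  shows "(\<integral>\<^sup>+x. f x \<partial>lborel) * (\<integral>\<^sup>+x. g x \<partial>lborel) \<le> (\<integral>\<^sup>+x. h x \<partial>lborel)\<^sup>2"
proof (cases "(SUP x. f x) = 0 \<or> (SUP x. g x) = 0")
  case True
  then have "(\<forall>x. f x = 0) \<or> (\<forall>x. g x = 0)"
    by (metis SUP_upper UNIV_I le_zero_eq)
  then show ?thesis by auto
next
  case False
  then obtain a b where ab: "(SUP x. f x) = ennreal a" "(SUP x. g x) = ennreal b" "0 < a" "0 < b"
    using bd by (metis ennreal_0 ennreal_cases infinity_ennreal_def less_le top.not_eq_extremum)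
  \<comment> \<open>The geometric mean of the factors \<open>1 / a\<close> and \<open>1 / b\<close>,
    so that the pointwise hypothesis survives the rescaling.\<close>
  define c where "c = 1 / sqrt (a * b)"
  have c: "0 < c" "c * c = (1/a) * (1/b)"
    using ab by (auto simp: c_def)
  have cc: "ennreal (1/a) * ennreal (1/b) = ennreal c * ennreal c"
    using ab c by (simp flip: ennreal_mult)
  let ?I = "\<lambda>f. (\<integral>\<^sup>+x. f x \<partial>lborel)"
  have inv: "ennreal (1/a) * ennreal a = 1" if "a > 0" for a
    using that by (metis divide_self_if ennreal_1 ennreal_mult' less_imp_le mult.commute mult.right_neutral not_less_iff_gr_or_eq times_divide_eq_right zero_le_divide_1_iff)
  have "?I (\<lambda>x. ennreal (1/a) * f x) + ?I (\<lambda>x. ennreal (1/b) * g x) \<le> 2 * ?I (\<lambda>x. ennreal c * h x)"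
  proof (rule prekopa_leindler_normalized)
    show "(SUP x. ennreal (1/a) * f x) = 1" "(SUP x. ennreal (1/b) * g x) = 1"
      using ab inv by (simp_all add: SUP_mult_left_ennreal[symmetric])
    fix x y
    have "ennreal (1/a) * f x * (ennreal (1/b) * g y) = (ennreal (1/a) * ennreal (1/b)) * (f x * g y)"
      by (simp add: ac_simps)
    also have "\<dots> \<le> (ennreal c * ennreal c) * (h ((x + y) / 2))\<^sup>2"
      unfolding cc by (intro mult_left_mono le) simp
    finally show "ennreal (1/a) * f x * (ennreal (1/b) * g y) \<le> (ennreal c * h ((x + y) / 2))\<^sup>2"
      by (simp add: power2_eq_square ac_simps)
  qed measurable
  then have *: "ennreal (1/a) * ?I f + ennreal (1/b) * ?I g \<le> 2 * (ennreal c * ?I h)"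
    by (simp add: nn_integral_cmult)
  have "4 * ((ennreal (1/a) * ?I f) * (ennreal (1/b) * ?I g)) \<le> (2 * (ennreal c * ?I h))\<^sup>2"
    using order_trans[OF ennreal_amgm power_mono[OF *]] by simp
  also have "(ennreal (1/a) * ?I f) * (ennreal (1/b) * ?I g) = (ennreal c * ennreal c) * (?I f * ?I g)"
    by (simp add: cc[symmetric] ac_simps)
  also have "(2 * (ennreal c * ?I h))\<^sup>2 = 4 * ((ennreal c * ennreal c) * (?I h)\<^sup>2)"
    by (simp add: power2_eq_square ac_simps)
  finally have "ennreal (4 * (c * c)) * (?I f * ?I g) \<le> ennreal (4 * (c * c)) * (?I h)\<^sup>2"
    using c(1) by (simp add: ennreal_mult' mult.assoc)
  then show ?thesis
    using c(1) by (subst (asm) ennreal_mult_le_mult_iff) (simp_all add: ennreal_eq_0_iff mult_le_0_iff)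
qed

lemma SUP_min_of_nat: "(SUP n. min (x::ennreal) (of_nat n)) = x"
proof (cases "x = \<infinity>")
  case True
  then show ?thesis by (simp add: ennreal_SUP_of_nat_eq_top)
next
  case False
  then obtain n where n: "x \<le> of_nat n"
    by (metis ennreal_Ex_less_of_nat infinity_ennreal_def less_imp_le top.not_eq_extremum)
  show ?thesis
  proof (rule antisym)
    show "x \<le> (SUP n. min x (of_nat n))"
      using n by (intro SUP_upper2[of n]) auto
  qed (auto intro!: SUP_least)
qed

lemma SUP_mult_SUP_le:
  fixes a b :: "nat \<Rightarrow> ennreal"
  assumes "\<And>m n. a m * b n \<le> c"
  shows "(SUP n. a n) * (SUP n. b n) \<le> c"
  using assms by (simp add: SUP_mult_left_ennreal SUP_mult_right_ennreal SUP_least)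

text \<open>Truncating \<open>f\<close> and \<open>g\<close> makes their suprema finite and only
  strengthens the hypothesis. The two truncation levels vary independently, so the product of the
  limits is the supremum of the products.\<close>

lemma prekopa_leindler_real:
  fixes f g h :: "real \<Rightarrow> ennreal"
  assumes [measurable]: "f \<in> borel_measurable borel" "g \<in> borel_measurable borel" "h \<in> borel_measurable borel"
    and le: "\<And>x y. f x * g y \<le> (h ((x + y) / 2))\<^sup>2"
  shows "(\<integral>\<^sup>+x. f x \<partial>lborel) * (\<integral>\<^sup>+x. g x \<partial>lborel) \<le> (\<integral>\<^sup>+x. h x \<partial>lborel)\<^sup>2"
proof -
  have lim: "(\<integral>\<^sup>+x. f x \<partial>lborel) = (SUP n. \<integral>\<^sup>+x. min (f x) (of_nat n) \<partial>lborel)"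
    if [measurable]: "f \<in> borel_measurable borel" for f :: "real \<Rightarrow> ennreal"
  proof -
    have "(\<integral>\<^sup>+x. f x \<partial>lborel) = (\<integral>\<^sup>+x. (SUP n. min (f x) (of_nat n)) \<partial>lborel)"
      by (simp only: SUP_min_of_nat)
    also have "\<dots> = (SUP n. \<integral>\<^sup>+x. min (f x) (of_nat n) \<partial>lborel)"
      by (intro nn_integral_monotone_convergence_SUP)
        (auto simp: incseq_def le_fun_def intro!: min.mono[OF order_refl, simplified])
    finally show ?thesis .
  qed
  have "(\<integral>\<^sup>+x. min (f x) (of_nat m) \<partial>lborel) * (\<integral>\<^sup>+x. min (g x) (of_nat n) \<partial>lborel) \<le> (\<integral>\<^sup>+x. h x \<partial>lborel)\<^sup>2"
    for m n
  proof (rule prekopa_leindler_bounded)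
    have bd: "(SUP x. min (F x) (of_nat k)) < \<infinity>" for F :: "real \<Rightarrow> ennreal" and k
      by (rule le_less_trans[of _ "of_nat k"]) (auto intro!: SUP_least simp: ennreal_of_nat_eq_real_of_nat)
    show "(SUP x. min (f x) (of_nat m)) < \<infinity>" "(SUP x. min (g x) (of_nat n)) < \<infinity>"
      by (rule bd)+
    show "min (f x) (of_nat m) * min (g y) (of_nat n) \<le> (h ((x + y) / 2))\<^sup>2" for x y
      by (rule order_trans[OF mult_mono le]) auto
  qed measurable
  then show ?thesis
    by (subst (1 2) lim) (simp_all add: SUP_mult_SUP_le)
qed

section \<open>The multiplicative form on the half-line\<close>

lemma indicator_le_indicator: "(x \<in> A \<Longrightarrow> x \<in> B) \<Longrightarrow> indicator A x \<le> (indicator B x :: ennreal)"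
  by (auto simp: indicator_def)

lemma nn_integral_exp_substitution:
  fixes F :: "real \<Rightarrow> ennreal"
  assumes [measurable]: "F \<in> borel_measurable borel"
  shows "(\<integral>\<^sup>+t. indicator {0<..} t * F t \<partial>lborel) = (\<integral>\<^sup>+u. F (exp u) * ennreal (exp u) \<partial>lborel)"
proof -
  \<comment> \<open>Substitution on compact intervals that exhaust the line, with their images
    exhausting the half-line; \<open>Suc n\<close> keeps the first interval nondegenerate.\<close>
  have step: "(\<integral>\<^sup>+x. F x * indicator {exp (- real (Suc n)) .. exp (real (Suc n))} x \<partial>lborel)
     = (\<integral>\<^sup>+x. F (exp x) * exp x * indicator {- real (Suc n) .. real (Suc n)} x \<partial>lborel)" for n
    by (rule nn_integral_substitution_aux) (auto intro!: derivative_eq_intros continuous_intros)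
  have sup1: "(SUP n. indicator {exp (- real (Suc n)) .. exp (real (Suc n))} x) = (indicator {0<..} x :: ennreal)" for x :: real
  proof (cases "0 < x")
    case True
    obtain n where "\<bar>ln x\<bar> \<le> real n" using real_arch_simple by blast
    then have n: "x \<in> {exp (- real (Suc n)) .. exp (real (Suc n))}"
      using True by (auto simp: ln_ge_iff ln_le_cancel_iff abs_le_iff ln_exp[symmetric] simp del: ln_exp)
       (smt (verit) exp_ln exp_le_cancel_iff)+
    have "(SUP n. indicator {exp (- real (Suc n)) .. exp (real (Suc n))} x) = (1::ennreal)"
      by (rule antisym, rule SUP_least, simp add: indicator_def, rule SUP_upper2[of n]) (use n in \<open>auto simp: indicator_def\<close>)
    then show ?thesis using True by simp
  next
    case False
    then have "x \<notin> {exp (- real (Suc n)) .. exp (real (Suc n))}" for n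
      using exp_gt_zero[of "- real (Suc n)"] by (auto simp: not_less simp del: exp_gt_zero of_nat_Suc)
    then have "indicator {exp (- real (Suc n)) .. exp (real (Suc n))} x = (0 :: ennreal)" for n
      by (rule indicator_simps(2))
    then show ?thesis using False by (simp del: of_nat_Suc)
  qed
  have sup2: "(SUP n. indicator {- real (Suc n) .. real (Suc n)} x) = (1 :: ennreal)" for x :: real
  proof -
    obtain n where "\<bar>x\<bar> \<le> real n" using real_arch_simple by blast
    then show ?thesis
      by (intro antisym SUP_least, simp add: indicator_def, intro SUP_upper2[of n]) (auto simp: indicator_def)
  qed
  have exp_incl: "x \<in> {exp (- real (Suc n)) .. exp (real (Suc n))}"
    if "m \<le> n" "x \<in> {exp (- real (Suc m)) .. exp (real (Suc m))}" for m n and x :: real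
    using that order_trans[of "exp (- real (Suc n))" "exp (- real (Suc m))" x]
      order_trans[of x "exp (real (Suc m))" "exp (real (Suc n))"] by simp
  have "(\<integral>\<^sup>+t. indicator {0<..} t * F t \<partial>lborel)
     = (\<integral>\<^sup>+t. (SUP n. F t * indicator {exp (- real (Suc n)) .. exp (real (Suc n))} t) \<partial>lborel)"
    by (simp only: SUP_mult_left_ennreal[symmetric] sup1 mult.commute)
  also have "\<dots> = (SUP n. \<integral>\<^sup>+t. F t * indicator {exp (- real (Suc n)) .. exp (real (Suc n))} t \<partial>lborel)"
  proof (intro nn_integral_monotone_convergence_SUP)
    show "incseq (\<lambda>n t. F t * indicator {exp (- real (Suc n)) .. exp (real (Suc n))} t)"
      unfolding incseq_def le_fun_def
      by (intro allI impI mult_left_mono indicator_le_indicator, erule exp_incl) auto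
  qed measurable
  also have "\<dots> = (SUP n. \<integral>\<^sup>+x. F (exp x) * exp x * indicator {- real (Suc n) .. real (Suc n)} x \<partial>lborel)"
    by (simp only: step)
  also have "\<dots> = (\<integral>\<^sup>+x. (SUP n. F (exp x) * exp x * indicator {- real (Suc n) .. real (Suc n)} x) \<partial>lborel)"
    by (intro nn_integral_monotone_convergence_SUP[symmetric])
       (auto simp: incseq_def le_fun_def indicator_def)
  also have "\<dots> = (\<integral>\<^sup>+u. F (exp u) * ennreal (exp u) \<partial>lborel)"
    by (simp only: SUP_mult_left_ennreal[symmetric] sup2) simp
  finally show ?thesis .
qed

text \<open>In logarithmic coordinates geometric means become midpoints. The Jacobian is itself
  multiplicative, \<open>exp x * exp y\<close> being the square of \<open>exp ((x + y) / 2)\<close>,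
  so it is absorbed on both sides.\<close>

lemma prekopa_leindler_mult:
  fixes F G H :: "real \<Rightarrow> ennreal"
  assumes [measurable]: "F \<in> borel_measurable borel" "G \<in> borel_measurable borel" "H \<in> borel_measurable borel"
    and le: "\<And>s t. 0 < s \<Longrightarrow> 0 < t \<Longrightarrow> F s * G t \<le> (H (sqrt (s * t)))\<^sup>2"
  shows "(\<integral>\<^sup>+t. indicator {0<..} t * F t \<partial>lborel) * (\<integral>\<^sup>+t. indicator {0<..} t * G t \<partial>lborel)
    \<le> (\<integral>\<^sup>+t. indicator {0<..} t * H t \<partial>lborel)\<^sup>2"
  unfolding nn_integral_exp_substitution[OF assms(1)] nn_integral_exp_substitution[OF assms(2)]
    nn_integral_exp_substitution[OF assms(3)]
proof (rule prekopa_leindler_real)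
  fix x y :: real
  have s: "sqrt (exp x * exp y) = exp ((x + y) / 2)"
    by (rule real_sqrt_unique) (auto simp: power2_eq_square simp flip: exp_add)
  have "F (exp x) * ennreal (exp x) * (G (exp y) * ennreal (exp y)) = (F (exp x) * G (exp y)) * ennreal (exp x * exp y)"
    by (simp add: ennreal_mult' ac_simps)
  also have "\<dots> \<le> (H (exp ((x + y) / 2)))\<^sup>2 * ennreal (exp x * exp y)"
    using le[of "exp x" "exp y"] unfolding s by (intro mult_right_mono) auto
  also have "ennreal (exp x * exp y) = (ennreal (exp ((x + y) / 2)))\<^sup>2"
    by (simp add: ennreal_power power2_eq_square flip: exp_add ennreal_mult)
  finally show "F (exp x) * ennreal (exp x) * (G (exp y) * ennreal (exp y))
      \<le> (H (exp ((x + y) / 2)) * ennreal (exp ((x + y) / 2)))\<^sup>2"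
    by (simp add: power_mult_distrib)
qed measurable

section \<open>Lebesgue measure on subspaces\<close>

definition orthonormal :: "'a::euclidean_space set \<Rightarrow> bool" where
  "orthonormal B \<longleftrightarrow> finite B \<and> pairwise orthogonal B \<and> (\<forall>b\<in>B. norm b = 1)"

text \<open>Lebesgue measure on the span of the orthonormal set \<open>B\<close>, as a measure on the ambient space, so that
  an induction on the dimension stays within one type.\<close>

definition span_measure :: "'a::euclidean_space set \<Rightarrow> 'a measure" where
  "span_measure B = distr (\<Pi>\<^sub>M b\<in>B. lborel) borel (\<lambda>f. \<Sum>b\<in>B. f b *\<^sub>R b)"

text \<open>Left unnormalized, so that it splits along orthogonal directions without constants. The
  general type lets it weigh points of the space as well as real heights.\<close>

definition gauss :: "'a::real_normed_vector \<Rightarrow> ennreal" where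
  "gauss x = ennreal (exp (- (norm x)\<^sup>2 / 2))"

interpretation lborel_product: product_sigma_finite "\<lambda>_. lborel :: real measure"
  by standard

lemma sets_span_measure [simp, measurable_cong]: "sets (span_measure B) = sets borel"
  by (simp add: span_measure_def)

lemma space_span_measure [simp]: "space (span_measure B) = UNIV"
  by (simp add: span_measure_def)

lemma measurable_sum_scaleR [measurable]:
  "(\<lambda>f. \<Sum>b\<in>B. f b *\<^sub>R b) \<in> (\<Pi>\<^sub>M b\<in>B. (lborel :: real measure)) \<rightarrow>\<^sub>M (borel :: 'a::euclidean_space measure)"
  by measurable

lemma gauss_measurable [measurable]: "gauss \<in> borel_measurable (borel :: 'a::euclidean_space measure)"
  unfolding gauss_def by measurable



lemma gauss_minus [simp]: "gauss (- x) = gauss x"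
  by (simp add: gauss_def)

lemma orthonormal_empty [simp]: "orthonormal {}"
  by (simp add: orthonormal_def)

lemma orthonormal_finite: "orthonormal B \<Longrightarrow> finite B"
  by (simp add: orthonormal_def)

lemma orthonormal_insertD:
  assumes "orthonormal (insert b B)" "b \<notin> B"
  shows "orthonormal B" "norm b = 1" "b \<bullet> b = 1" "\<And>x. x \<in> span B \<Longrightarrow> x \<bullet> b = 0"
proof -
  show "orthonormal B" "norm b = 1" "b \<bullet> b = 1"
    using assms by (auto simp: orthonormal_def pairwise_insert norm_eq_1)
  fix x assume "x \<in> span B"
  moreover have "orthogonal b y" if "y \<in> B" for y
    using assms that by (auto simp: orthonormal_def pairwise_insert)
  ultimately have "orthogonal b x"
    using orthogonal_to_span by blast
  then show "x \<bullet> b = 0"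
    by (simp add: orthogonal_def inner_commute)
qed

lemma orthonormal_induct [consumes 1, case_names empty insert]:
  assumes "orthonormal B"
    and "P {}"
    and "\<And>b B. orthonormal (insert b B) \<Longrightarrow> b \<notin> B \<Longrightarrow> finite B \<Longrightarrow> orthonormal B \<Longrightarrow> P B \<Longrightarrow> P (insert b B)"
  shows "P B"
proof -
  have "finite B" using assms(1) by (rule orthonormal_finite)
  then show ?thesis
    using assms(1)
  proof (induction B)
    case (insert b B)
    then show ?case using assms(3) orthonormal_insertD(1) by blast
  qed (rule assms(2))
qed

lemma nn_integral_span_measure:
  assumes [measurable]: "f \<in> borel_measurable borel"
  shows "(\<integral>\<^sup>+x. f x \<partial>span_measure B) = (\<integral>\<^sup>+\<omega>. f (\<Sum>b\<in>B. \<omega> b *\<^sub>R b) \<partial>(\<Pi>\<^sub>M b\<in>B. lborel))"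
  unfolding span_measure_def by (subst nn_integral_distr) (auto simp: comp_def)

lemma nn_integral_span_measure_empty [simp]:
  assumes [measurable]: "f \<in> borel_measurable borel"
  shows "(\<integral>\<^sup>+x. f x \<partial>span_measure {}) = f 0"
  by (simp add: nn_integral_span_measure PiM_empty nn_integral_count_space_finite)

lemma nn_integral_span_measure_insert:
  assumes B: "finite B" "b \<notin> B" and [measurable]: "f \<in> borel_measurable borel"
  shows "(\<integral>\<^sup>+x. f x \<partial>span_measure (insert b B)) = (\<integral>\<^sup>+x. (\<integral>\<^sup>+t. f (x + t *\<^sub>R b) \<partial>lborel) \<partial>span_measure B)"
proof -
  have "(\<integral>\<^sup>+x. f x \<partial>span_measure (insert b B))
    = (\<integral>\<^sup>+\<omega>. (\<integral>\<^sup>+t. f (\<Sum>i\<in>insert b B. fun_upd \<omega> b t i *\<^sub>R i) \<partial>lborel) \<partial>(\<Pi>\<^sub>M b\<in>B. lborel))"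
    using B by (simp only: nn_integral_span_measure assms(3)) (rule lborel_product.product_nn_integral_insert; simp)
  also have "\<dots> = (\<integral>\<^sup>+\<omega>. (\<integral>\<^sup>+t. f ((\<Sum>i\<in>B. \<omega> i *\<^sub>R i) + t *\<^sub>R b) \<partial>lborel) \<partial>(\<Pi>\<^sub>M b\<in>B. lborel))"
  proof -
    have "(\<Sum>i\<in>B. fun_upd \<omega> b t i *\<^sub>R i) = (\<Sum>i\<in>B. \<omega> i *\<^sub>R i)" for \<omega> :: "'a \<Rightarrow> real" and t
      using B by (intro sum.cong) auto
    then show ?thesis using B by (simp add: add.commute)
  qed
  also have "\<dots> = (\<integral>\<^sup>+x. (\<integral>\<^sup>+t. f (x + t *\<^sub>R b) \<partial>lborel) \<partial>span_measure B)"
    by (subst nn_integral_span_measure) measurable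
  finally show ?thesis .
qed

lemma AE_span_measure: "AE x in span_measure B. x \<in> span B"
proof -
  have [measurable]: "span B \<in> sets borel" by (simp add: closed_span)
  show ?thesis
    unfolding span_measure_def
    by (subst AE_distr_iff) (auto intro!: AE_I2 span_sum intro: span_scale span_base)
qed

lemma nn_integral_span_measure_cong:
  assumes "\<And>x. x \<in> span B \<Longrightarrow> f x = g x"
  shows "(\<integral>\<^sup>+x. f x \<partial>span_measure B) = (\<integral>\<^sup>+x. g x \<partial>span_measure B)"
  using AE_span_measure[of B] assms by (intro nn_integral_cong_AE) auto

lemma nn_integral_span_measure_mono:
  assumes "\<And>x. x \<in> span B \<Longrightarrow> f x \<le> g x"
  shows "(\<integral>\<^sup>+x. f x \<partial>span_measure B) \<le> (\<integral>\<^sup>+x. g x \<partial>span_measure B)"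
  using AE_span_measure[of B] assms by (intro nn_integral_mono_AE) auto

section \<open>Gaussian integrals and finiteness on balls\<close>

lemma norm_add_orthogonal_unit:
  assumes "x \<bullet> b = 0" "norm b = 1"
  shows "norm (x + t *\<^sub>R b) = sqrt ((norm x)\<^sup>2 + t\<^sup>2)"
proof -
  have "(norm (x + t *\<^sub>R b))\<^sup>2 = (norm x)\<^sup>2 + t\<^sup>2"
    using assms unfolding power2_norm_eq_inner
    by (simp add: algebra_simps inner_commute norm_eq_1 power2_eq_square)
  then show ?thesis by (metis norm_ge_zero real_sqrt_unique)
qed

lemma gauss_add_orthogonal_unit:
  assumes "x \<bullet> b = 0" "norm b = 1"
  shows "gauss (x + t *\<^sub>R b) = gauss x * gauss t"
  using assms by (simp add: gauss_def norm_add_orthogonal_unit add_divide_distrib flip: ennreal_mult exp_add)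

lemma nn_integral_gauss_real: "(\<integral>\<^sup>+t. gauss (t::real) \<partial>lborel) = ennreal (sqrt (2 * pi))"
proof -
  have "(\<integral>\<^sup>+t. ennreal (std_normal_density t) \<partial>lborel) = 1"
    using prob_space.emeasure_space_1[OF prob_space_normal_density[of 1 0]]
    by (simp add: emeasure_density cong: nn_integral_cong)
  moreover have "gauss t = ennreal (sqrt (2 * pi)) * ennreal (std_normal_density t)" for t :: real
    by (simp add: gauss_def std_normal_density_def flip: ennreal_mult)
  ultimately show ?thesis
    by (simp add: nn_integral_cmult)
qed

lemma nn_integral_lborel_split:
  fixes f :: "real \<Rightarrow> ennreal"
  assumes [measurable]: "f \<in> borel_measurable borel"
  shows "(\<integral>\<^sup>+t. f t \<partial>lborel) = (\<integral>\<^sup>+t. indicator {0<..} t * f t \<partial>lborel) + (\<integral>\<^sup>+t. indicator {0<..} t * f (- t) \<partial>lborel)"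
proof -
  have "(\<integral>\<^sup>+t. f t \<partial>lborel) = (\<integral>\<^sup>+t. indicator {0<..} t * f t + indicator {..<0} t * f t \<partial>lborel)"
    by (intro nn_integral_cong_AE, use AE_lborel_singleton[of "0::real"] in eventually_elim)
       (auto simp: indicator_def)
  also have "\<dots> = (\<integral>\<^sup>+t. indicator {0<..} t * f t \<partial>lborel) + (\<integral>\<^sup>+t. indicator {..<0} t * f t \<partial>lborel)"
    by (subst nn_integral_add) auto
  also have "(\<integral>\<^sup>+t. indicator {..<0} t * f t \<partial>lborel) = (\<integral>\<^sup>+t. indicator {0<..} t * f (- t) \<partial>lborel)"
    by (subst nn_integral_real_affine[where c = "-1" and t = 0]) (auto intro!: nn_integral_cong simp: indicator_def)
  finally show ?thesis .
qed

lemma nn_integral_gauss_half: "(\<integral>\<^sup>+t. indicator {0<..} t * gauss (t::real) \<partial>lborel) = ennreal (sqrt (pi / 2))"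
proof -
  let ?h = "\<integral>\<^sup>+t. indicator {0<..} t * gauss (t::real) \<partial>lborel"
  have "ennreal (sqrt (2 * pi)) = 2 * ?h"
    using nn_integral_lborel_split[of gauss] by (simp add: nn_integral_gauss_real flip: mult_2)
  moreover have "sqrt (2 * pi) = 2 * sqrt (pi / 2)"
    by (simp add: real_sqrt_mult real_sqrt_divide field_simps)
  ultimately have "2 * ?h = 2 * ennreal (sqrt (pi / 2))"
    by (simp add: ennreal_mult)
  then show ?thesis
    by (simp add: ennreal_mult_cancel_left)
qed

lemma nn_integral_gauss_span:
  assumes "orthonormal B"
  shows "(\<integral>\<^sup>+x. gauss x \<partial>span_measure B) = ennreal (sqrt (2 * pi) ^ card B)"
  using assms
proof (induction B rule: orthonormal_induct)
  case empty
  show ?case by (simp add: gauss_def)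
next
  case (insert b B)
  note b = orthonormal_insertD[OF insert(1,2)]
  have "(\<integral>\<^sup>+x. gauss x \<partial>span_measure (insert b B))
    = (\<integral>\<^sup>+x. gauss x * ennreal (sqrt (2 * pi)) \<partial>span_measure B)"
    unfolding nn_integral_span_measure_insert[OF insert(3,2) gauss_measurable]
  proof (rule nn_integral_span_measure_cong)
    fix x assume "x \<in> span B"
    then have "(\<integral>\<^sup>+t. gauss (x + t *\<^sub>R b) \<partial>lborel) = (\<integral>\<^sup>+t. gauss x * gauss (t::real) \<partial>lborel)"
      using b by (simp add: gauss_add_orthogonal_unit)
    then show "(\<integral>\<^sup>+t. gauss (x + t *\<^sub>R b) \<partial>lborel) = gauss x * ennreal (sqrt (2 * pi))"
      by (simp add: nn_integral_cmult nn_integral_gauss_real)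
  qed
  then show ?case
    using insert by (simp add: nn_integral_multc ennreal_mult mult.commute)
qed

text \<open>Markov's inequality: the Gaussian density is bounded below on the ball and has a finite
  integral.\<close>

lemma emeasure_span_measure_cball_finite:
  assumes "orthonormal B"
  shows "emeasure (span_measure B) (cball 0 r) < \<infinity>"
proof -
  let ?c = "ennreal (exp (- r\<^sup>2 / 2))"
  have "?c * emeasure (span_measure B) (cball 0 r) = (\<integral>\<^sup>+x. ?c * indicator (cball 0 r) x \<partial>span_measure B)"
    by (rule nn_integral_cmult_indicator[symmetric]) simp
  also have "\<dots> \<le> (\<integral>\<^sup>+x. gauss x \<partial>span_measure B)"
    by (intro nn_integral_mono) (auto simp: gauss_def indicator_def intro!: ennreal_leI power_mono)
  also have "\<dots> < \<infinity>"
    by (simp add: nn_integral_gauss_span[OF assms])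
  finally show ?thesis
    by (auto simp: ennreal_mult_less_top ennreal_eq_0_iff)
qed

lemma sigma_finite_span_measure:
  assumes "orthonormal B"
  shows "sigma_finite_measure (span_measure B)"
proof
  show "\<exists>A. countable A \<and> A \<subseteq> sets (span_measure B) \<and> \<Union> A = space (span_measure B) \<and>
      (\<forall>a\<in>A. emeasure (span_measure B) a \<noteq> \<infinity>)"
  proof (intro exI conjI)
    show "\<Union> (range (\<lambda>n::nat. cball (0::'a) (real n))) = space (span_measure B)"
      using real_arch_simple by (auto simp: dist_norm)
  qed (use emeasure_span_measure_cball_finite[OF assms] in \<open>auto simp: less_top\<close>)
qed

lemma nn_integral_span_measure_swap:
  assumes "orthonormal B" "sigma_finite_measure M" "(\<lambda>(x, t). f x t) \<in> borel_measurable (borel \<Otimes>\<^sub>M M)"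
  shows "(\<integral>\<^sup>+x. (\<integral>\<^sup>+t. f x t \<partial>M) \<partial>span_measure B) = (\<integral>\<^sup>+t. (\<integral>\<^sup>+x. f x t \<partial>span_measure B) \<partial>M)"
proof -
  interpret pair_sigma_finite M "span_measure B"
    using assms by (simp add: pair_sigma_finite_def sigma_finite_span_measure)
  have "(\<lambda>(t, x). f x t) \<in> borel_measurable (M \<Otimes>\<^sub>M span_measure B)"
    using measurable_pair_swap[OF assms(3)] by (simp add: case_prod_beta' measurable_split_conv cong: measurable_cong_sets)
  then show ?thesis
    by (rule Fubini'[of "\<lambda>t x. f x t"])
qed

lemma nn_integral_span_measure_translate:
  assumes "orthonormal B" "z \<in> span B" "f \<in> borel_measurable borel"
  shows "(\<integral>\<^sup>+x. f (x + z) \<partial>span_measure B) = (\<integral>\<^sup>+x. f x \<partial>span_measure B)"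
  using assms
proof (induction B arbitrary: z f rule: orthonormal_induct)
  case (insert b B)
  note [measurable] = insert(7)
  obtain k where k: "z - k *\<^sub>R b \<in> span B"
    using insert(6) by (auto simp: span_insert)
  have "(\<integral>\<^sup>+x. f (x + z) \<partial>span_measure (insert b B))
    = (\<integral>\<^sup>+x. (\<integral>\<^sup>+t. f ((x + (z - k *\<^sub>R b)) + (k + 1 * t) *\<^sub>R b) \<partial>lborel) \<partial>span_measure B)"
    using insert.hyps by (subst nn_integral_span_measure_insert) (simp_all add: algebra_simps)
  also have "\<dots> = (\<integral>\<^sup>+x. (\<integral>\<^sup>+t. f ((x + (z - k *\<^sub>R b)) + t *\<^sub>R b) \<partial>lborel) \<partial>span_measure B)"
    by (subst (2) nn_integral_real_affine[where c = 1 and t = k]) auto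
  also have "\<dots> = (\<integral>\<^sup>+x. (\<integral>\<^sup>+t. f (x + t *\<^sub>R b) \<partial>lborel) \<partial>span_measure B)"
    by (rule insert.IH[OF k]) measurable
  also have "\<dots> = (\<integral>\<^sup>+x. f x \<partial>span_measure (insert b B))"
    using insert.hyps by (subst nn_integral_span_measure_insert) simp_all
  finally show ?case .
qed simp

lemma nn_integral_span_measure_scale:
  assumes "orthonormal B" "0 < r" "f \<in> borel_measurable borel"
  shows "(\<integral>\<^sup>+x. f x \<partial>span_measure B) = ennreal (r ^ card B) * (\<integral>\<^sup>+x. f (r *\<^sub>R x) \<partial>span_measure B)"
  using assms
proof (induction B arbitrary: f rule: orthonormal_induct)
  case (insert b B)
  note [measurable] = insert(7)
  have "(\<integral>\<^sup>+x. f x \<partial>span_measure (insert b B))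
    = (\<integral>\<^sup>+x. (\<integral>\<^sup>+t. f (x + t *\<^sub>R b) \<partial>lborel) \<partial>span_measure B)"
    using insert.hyps by (subst nn_integral_span_measure_insert) simp_all
  also have "\<dots> = (\<integral>\<^sup>+x. ennreal r * (\<integral>\<^sup>+t. f (x + (r * t) *\<^sub>R b) \<partial>lborel) \<partial>span_measure B)"
  proof (rule nn_integral_cong)
    fix x
    show "(\<integral>\<^sup>+t. f (x + t *\<^sub>R b) \<partial>lborel) = ennreal r * (\<integral>\<^sup>+t. f (x + (r * t) *\<^sub>R b) \<partial>lborel)"
      using \<open>0 < r\<close> nn_integral_real_affine[of "\<lambda>t. f (x + t *\<^sub>R b)" r 0] by simp
  qed
  also have "\<dots> = ennreal (r ^ card B) * (\<integral>\<^sup>+x. ennreal r * (\<integral>\<^sup>+t. f (r *\<^sub>R x + (r * t) *\<^sub>R b) \<partial>lborel) \<partial>span_measure B)"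
    using insert.prems by (intro insert.IH) measurable
  also have "\<dots> = ennreal (r ^ card (insert b B)) * (\<integral>\<^sup>+x. (\<integral>\<^sup>+t. f (r *\<^sub>R (x + t *\<^sub>R b)) \<partial>lborel) \<partial>span_measure B)"
    using insert.hyps insert.prems(2) \<open>0 < r\<close> by (subst nn_integral_cmult) (simp_all add: algebra_simps ennreal_mult)
  also have "(\<integral>\<^sup>+x. (\<integral>\<^sup>+t. f (r *\<^sub>R (x + t *\<^sub>R b)) \<partial>lborel) \<partial>span_measure B) = (\<integral>\<^sup>+x. f (r *\<^sub>R x) \<partial>span_measure (insert b B))"
    using insert.hyps by (subst nn_integral_span_measure_insert) simp_all
  finally show ?case .
qed simp

text \<open>A substitute for rotation invariance between two possibly different spans. Integrating
  out one coordinate of a radial function leaves a radial function, the same for both bases, so the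
  induction varies \<open>h\<close> and \<open>C\<close>.\<close>

lemma nn_integral_span_measure_radial:
  fixes B C :: "'a::euclidean_space set"
  assumes "orthonormal B" "orthonormal C" "card B = card C" "h \<in> borel_measurable borel"
  shows "(\<integral>\<^sup>+x. h (norm x) \<partial>span_measure B) = (\<integral>\<^sup>+x. h (norm x) \<partial>span_measure C)"
  using assms
proof (induction B arbitrary: C h rule: orthonormal_induct)
  case empty
  then show ?case by (auto dest: orthonormal_finite)
next
  case (insert b B)
  note [measurable] = insert.prems(3)
  obtain c C' where C: "C = insert c C'" "c \<notin> C'" "card C' = card B"
    using insert by (metis card_Suc_eq card_insert_disjoint)
  have oC: "orthonormal (insert c C')" using insert C by simp
  let ?k = "\<lambda>\<rho>. (\<integral>\<^sup>+t. h (sqrt (\<rho>\<^sup>2 + t\<^sup>2)) \<partial>lborel)"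
  have *: "(\<integral>\<^sup>+x. h (norm x) \<partial>span_measure (insert d D)) = (\<integral>\<^sup>+x. ?k (norm x) \<partial>span_measure D)"
    if "orthonormal (insert d D)" "d \<notin> D" for d and D :: "'a set"
    using orthonormal_insertD[OF that] that
    by (subst nn_integral_span_measure_insert)
       (auto simp: norm_add_orthogonal_unit orthonormal_finite intro!: nn_integral_span_measure_cong)
  have "(\<integral>\<^sup>+x. ?k (norm x) \<partial>span_measure B) = (\<integral>\<^sup>+x. ?k (norm x) \<partial>span_measure C')"
    using C orthonormal_insertD[OF oC C(2)] by (intro insert.IH[of C' ?k]) auto
  then show ?case
    unfolding C(1) by (simp only: *[OF insert.hyps(1,2)] *[OF oC C(2)])
qed

section \<open>Independence of the orthonormal basis\<close>

text \<open>The uniqueness proof for Haar measure with \<open>gauss\<close> as reference function: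
  \<open>gauss x * f (x + y)\<close> is integrated in two orders, and translation invariance
  together with the evenness of \<open>gauss\<close> decouples the variables each time.\<close>

lemma translation_invariant_gauss_ratio:
  fixes M N :: "'a::euclidean_space measure"
  assumes sf: "sigma_finite_measure M" "sigma_finite_measure N"
    and [measurable_cong, simp]: "sets M = sets borel" "sets N = sets borel"
    and M: "\<And>f z. f \<in> borel_measurable borel \<Longrightarrow> (\<integral>\<^sup>+x. f (x + z) \<partial>M) = (\<integral>\<^sup>+x. f x \<partial>M)"
    and N: "\<And>f z. f \<in> borel_measurable borel \<Longrightarrow> (\<integral>\<^sup>+x. f (x + z) \<partial>N) = (\<integral>\<^sup>+x. f x \<partial>N)"
    and [measurable]: "f \<in> borel_measurable borel"
  shows "(\<integral>\<^sup>+x. gauss x \<partial>M) * (\<integral>\<^sup>+x. f x \<partial>N) = (\<integral>\<^sup>+x. f x \<partial>M) * (\<integral>\<^sup>+x. gauss x \<partial>N)"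
proof -
  interpret pair_sigma_finite N M
    using sf by (simp add: pair_sigma_finite_def)
  have "(\<integral>\<^sup>+x. gauss x \<partial>M) * (\<integral>\<^sup>+x. f x \<partial>N) = (\<integral>\<^sup>+x. (\<integral>\<^sup>+y. gauss x * f (y + x) \<partial>N) \<partial>M)"
    by (simp add: N nn_integral_cmult nn_integral_multc)
  also have "\<dots> = (\<integral>\<^sup>+x. (\<integral>\<^sup>+y. gauss x * f (x + y) \<partial>N) \<partial>M)"
    by (simp only: add.commute)
  also have "\<dots> = (\<integral>\<^sup>+y. (\<integral>\<^sup>+x. gauss x * f (x + y) \<partial>M) \<partial>N)"
    by (rule Fubini') measurable
  also have "\<dots> = (\<integral>\<^sup>+y. (\<integral>\<^sup>+x. gauss (x - y) * f x \<partial>M) \<partial>N)"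
  proof (rule nn_integral_cong)
    fix y
    show "(\<integral>\<^sup>+x. gauss x * f (x + y) \<partial>M) = (\<integral>\<^sup>+x. gauss (x - y) * f x \<partial>M)"
      using M[of "\<lambda>x. gauss (x - y) * f x" y] by simp
  qed
  also have "\<dots> = (\<integral>\<^sup>+x. (\<integral>\<^sup>+y. f x * gauss (y + - x) \<partial>N) \<partial>M)"
  proof (subst Fubini'[symmetric])
    have "gauss (x - y) = gauss (y - x)" for x y :: 'a
      by (simp add: gauss_def norm_minus_commute)
    then show "(\<integral>\<^sup>+x. (\<integral>\<^sup>+y. gauss (x - y) * f x \<partial>N) \<partial>M) = (\<integral>\<^sup>+x. (\<integral>\<^sup>+y. f x * gauss (y + - x) \<partial>N) \<partial>M)"
      by (simp add: mult.commute)
  qed measurable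
  also have "\<dots> = (\<integral>\<^sup>+x. f x \<partial>M) * (\<integral>\<^sup>+x. gauss x \<partial>N)"
    using N[of gauss "- _"] by (simp add: nn_integral_cmult nn_integral_multc del: add_uminus_conv_diff)
  finally show ?thesis .
qed

lemma span_measure_Basis: "span_measure Basis = lborel"
  unfolding span_measure_def by (rule lborel_eq[symmetric])

lemma orthonormal_Basis: "orthonormal Basis"
  by (auto simp: orthonormal_def pairwise_def orthogonal_def inner_Basis)

text \<open>Two translation-invariant measures are proportional, and both give \<open>gauss\<close>
  the same finite nonzero integral, so the factor is 1.\<close>

lemma span_measure_eq_lborel:
  fixes B :: "'a::euclidean_space set"
  assumes "orthonormal B" "span B = UNIV" "card B = DIM('a)"
  shows "span_measure B = lborel"
proof (rule measure_eqI)
  fix A assume "A \<in> sets (span_measure B)"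
  then have [measurable]: "A \<in> sets borel" by simp
  let ?B = "Basis :: 'a set"
  let ?c = "ennreal (sqrt (2 * pi) ^ DIM('a))"
  have "(\<integral>\<^sup>+x. gauss x \<partial>span_measure B) * (\<integral>\<^sup>+x. indicator A x \<partial>span_measure ?B)
    = (\<integral>\<^sup>+x. indicator A x \<partial>span_measure B) * (\<integral>\<^sup>+x. gauss x \<partial>span_measure ?B)"
    using assms
    by (intro translation_invariant_gauss_ratio)
       (auto simp: sigma_finite_span_measure orthonormal_Basis nn_integral_span_measure_translate)
  then have "?c * emeasure lborel A = ?c * emeasure (span_measure B) A"
    using assms nn_integral_gauss_span[OF orthonormal_Basis, where ?'a = 'a]
    by (simp add: nn_integral_gauss_span span_measure_Basis mult.commute)
  then show "emeasure (span_measure B) A = emeasure lborel A"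
    by (simp add: ennreal_mult_cancel_left)
qed simp

section \<open>The functional Santalo inequality\<close>

lemma nn_integral_span_measure_uminus:
  assumes "orthonormal B" "f \<in> borel_measurable borel"
  shows "(\<integral>\<^sup>+x. f (- x) \<partial>span_measure B) = (\<integral>\<^sup>+x. f x \<partial>span_measure B)"
  using assms
proof (induction B arbitrary: f rule: orthonormal_induct)
  case (insert b B)
  note [measurable] = insert.prems
  have "(\<integral>\<^sup>+x. f (- x) \<partial>span_measure (insert b B))
    = (\<integral>\<^sup>+x. (\<integral>\<^sup>+t. f (- x + (- t) *\<^sub>R b) \<partial>lborel) \<partial>span_measure B)"
    using insert.hyps by (subst nn_integral_span_measure_insert) simp_all
  also have "\<dots> = (\<integral>\<^sup>+x. (\<integral>\<^sup>+t. f (- x + t *\<^sub>R b) \<partial>lborel) \<partial>span_measure B)"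
  proof (rule nn_integral_cong)
    fix x
    show "(\<integral>\<^sup>+t. f (- x + (- t) *\<^sub>R b) \<partial>lborel) = (\<integral>\<^sup>+t. f (- x + t *\<^sub>R b) \<partial>lborel)"
      using nn_integral_real_affine[of "\<lambda>t. f (- x + t *\<^sub>R b)" "-1" 0] by simp
  qed
  also have "\<dots> = (\<integral>\<^sup>+x. (\<integral>\<^sup>+t. f (x + t *\<^sub>R b) \<partial>lborel) \<partial>span_measure B)"
    by (rule insert.IH) measurable
  also have "\<dots> = (\<integral>\<^sup>+x. f x \<partial>span_measure (insert b B))"
    using insert.hyps by (subst nn_integral_span_measure_insert) simp_all
  finally show ?case .
qed simp

section \<open>Cutting a mass by a hyperplane\<close>

text \<open>The strip estimate makes the mass above level \<open>r\<close> a Lipschitz function of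
  \<open>r\<close>, so the intermediate value theorem supplies the level. The same estimate makes
  the level set itself null, so both open sides carry exactly half.\<close>

lemma finite_measure_halving:
  assumes "finite_measure M" and [measurable]: "h \<in> borel_measurable M"
    and strip: "\<And>s t. s \<le> t \<Longrightarrow> measure M {x\<in>space M. s < h x \<and> h x \<le> t} \<le> C * (t - s)"
    and bound: "AE x in M. \<bar>h x\<bar> \<le> (R :: real)"
  obtains r where "measure M {x\<in>space M. r < h x} = measure M (space M) / 2"
    "measure M {x\<in>space M. h x < r} = measure M (space M) / 2"
proof -
  interpret finite_measure M by fact
  define \<phi> where "\<phi> r = measure M {x\<in>space M. r < h x}" for r
  have diff: "\<phi> s - \<phi> t = measure M {x\<in>space M. s < h x \<and> h x \<le> t}" if "s \<le> t" for s t
  proof -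
    have "{x\<in>space M. s < h x} - {x\<in>space M. t < h x} = {x\<in>space M. s < h x \<and> h x \<le> t}"
      by auto
    moreover have "measure M ({x\<in>space M. s < h x} - {x\<in>space M. t < h x}) = \<phi> s - \<phi> t"
      unfolding \<phi>_def using that by (intro finite_measure_Diff) auto
    ultimately show ?thesis by simp
  qed
  have lip: "\<bar>\<phi> s - \<phi> t\<bar> \<le> C * \<bar>s - t\<bar>" for s t
  proof (cases "s \<le> t")
    case True
    then show ?thesis using diff[OF True] strip[OF True] by simp
  next
    case False
    then have "t \<le> s" by simp
    then have "0 \<le> \<phi> t - \<phi> s" "\<phi> t - \<phi> s \<le> C * (s - t)"
      using diff[of t s] strip[of t s] by simp_all
    with \<open>t \<le> s\<close> show ?thesis by (simp add: abs_if)
  qed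
  have "0 \<le> C"
    using order_trans[OF measure_nonneg strip[of 0 1]] by simp
  then have "C-lipschitz_on UNIV \<phi>"
    using lip by (auto intro!: lipschitz_onI simp: dist_real_def)
  then have cont: "continuous_on UNIV \<phi>"
    by (rule lipschitz_on_continuous_on)
  have lo: "\<phi> (- \<bar>R\<bar> - 1) = measure M (space M)"
    unfolding \<phi>_def using bound by (intro measure_eq_AE) (auto elim!: eventually_mono)
  have hi: "\<phi> (\<bar>R\<bar> + 1) = 0"
  proof -
    have "\<phi> (\<bar>R\<bar> + 1) = measure M {}"
      unfolding \<phi>_def using bound by (intro measure_eq_AE) (auto elim!: eventually_mono)
    then show ?thesis by simp
  qed
  obtain r where r: "\<phi> r = measure M (space M) / 2"
    using IVT2'[of \<phi> "\<bar>R\<bar> + 1" "measure M (space M) / 2" "- \<bar>R\<bar> - 1"] lo hi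
      continuous_on_subset[OF cont] by auto
  have null: "measure M {x\<in>space M. h x = r} \<le> C * e" if "0 < e" for e
  proof -
    have "measure M {x\<in>space M. h x = r} \<le> measure M {x\<in>space M. r - e < h x \<and> h x \<le> r}"
      using that by (intro finite_measure_mono) auto
    also have "\<dots> \<le> C * e"
      using strip[of "r - e" r] that by simp
    finally show ?thesis .
  qed
  have "measure M {x\<in>space M. h x = r} \<le> 0 + e" if "0 < e" for e
  proof -
    \<comment> \<open>\<open>C\<close> may be 0, hence the division by \<open>C + 1\<close>.\<close>
    have "measure M {x\<in>space M. h x = r} \<le> C * (e / (C + 1))"
      using that \<open>0 \<le> C\<close> by (intro null) auto
    also have "\<dots> \<le> e"
      using that \<open>0 \<le> C\<close> by (simp add: field_simps)
    finally show ?thesis by simp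
  qed
  then have "measure M {x\<in>space M. h x = r} = 0"
    using field_le_epsilon[of "measure M {x\<in>space M. h x = r}" 0] by (simp add: measure_le_0_iff)
  moreover have "measure M (space M) = measure M ({x\<in>space M. h x < r} \<union> {x\<in>space M. h x = r} \<union> {x\<in>space M. r < h x})"
    by (rule arg_cong[where f="measure M"]) auto
  moreover have "\<dots> = measure M {x\<in>space M. h x < r} + measure M {x\<in>space M. h x = r} + \<phi> r"
  proof -
    have "measure M ({x\<in>space M. h x < r} \<union> {x\<in>space M. h x = r} \<union> {x\<in>space M. r < h x})
      = measure M ({x\<in>space M. h x < r} \<union> {x\<in>space M. h x = r}) + \<phi> r"
      unfolding \<phi>_def by (rule finite_measure_Union) auto
    also have "measure M ({x\<in>space M. h x < r} \<union> {x\<in>space M. h x = r})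
      = measure M {x\<in>space M. h x < r} + measure M {x\<in>space M. h x = r}"
      by (rule finite_measure_Union) auto
    finally show ?thesis .
  qed
  ultimately have "measure M {x\<in>space M. h x < r} = measure M (space M) / 2"
    using r by linarith
  then show ?thesis
    using r unfolding \<phi>_def by (intro that[of r])
qed

text \<open>The component of the integral orthogonal to \<open>S\<close> pairs to zero with almost
  every value of \<open>h\<close>, hence with the integral, hence with itself.\<close>

lemma integral_in_subspace:
  fixes S :: "'a::euclidean_space set" and M :: "'b measure"
  assumes S: "subspace S" and int: "integrable M h" and "AE x in M. h x \<in> S"
  shows "(\<integral>x. h x \<partial>M) \<in> S"
proof -
  let ?I = "\<integral>x. h x \<partial>M"
  obtain y z where yz: "y \<in> span S" "\<And>w. w \<in> span S \<Longrightarrow> orthogonal z w" "?I = y + z"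
    by (rule orthogonal_subspace_decomp_exists[of S ?I]) (rule that)
  have "z \<bullet> ?I = (\<integral>x. z \<bullet> h x \<partial>M)"
    using int by (simp add: integral_inner_right)
  also have "\<dots> = (\<integral>x. 0 \<partial>M)"
    using assms yz by (intro integral_cong_AE) (auto simp: orthogonal_def span_eq_iff[THEN iffD2] elim!: eventually_mono)
  finally have "z \<bullet> ?I = 0" by simp
  then have "z = 0"
    using yz by (simp add: inner_add_right orthogonal_def)
  then show ?thesis using yz S by (simp add: span_eq_iff[THEN iffD2])
qed

text \<open>The segment joining the barycenters of the two halves meets the separating hyperplane in
  \<open>z\<close>, and \<open>d\<close> is its direction.\<close>

lemma halves_barycenter_axis:
  fixes M :: "'a::euclidean_space measure" and b :: 'a
  assumes "finite_measure M" and M[measurable_cong, simp]: "sets M = sets borel"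
    and S: "subspace S" "AE y in M. y \<in> S"
    and bound: "AE y in M. norm y \<le> R"
    and m: "measure M {y. r < y \<bullet> b} = m" "measure M {y. y \<bullet> b < r} = m" "0 < m"
  obtains z d where "z \<in> S" "d \<in> S" "z \<bullet> b = r" "d \<bullet> b = 1"
    "\<And>\<zeta>. (\<integral>y. indicator {y. r < y \<bullet> b} y * (\<zeta> \<bullet> (y - z - ((y - z) \<bullet> b) *\<^sub>R d)) \<partial>M) = 0"
    "\<And>\<zeta>. (\<integral>y. indicator {y. y \<bullet> b < r} y * (\<zeta> \<bullet> (y - z - ((y - z) \<bullet> b) *\<^sub>R d)) \<partial>M) = 0"
proof -
  interpret finite_measure M by fact
  have space[simp]: "space M = UNIV"
    using sets_eq_imp_space_eq[OF M] by simp
  let ?P = "{y. r < y \<bullet> b}" and ?N = "{y. y \<bullet> b < r}"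
  have int: "integrable M (\<lambda>y. indicator A y *\<^sub>R y)" if [measurable]: "A \<in> sets borel" for A
    using bound by (intro integrable_const_bound[where B="\<bar>R\<bar>"]) (auto simp: indicator_def elim!: eventually_mono)
  have int1: "integrable M (\<lambda>y. indicator A y :: real)" if [measurable]: "A \<in> sets borel" for A
    by (intro integrable_const_bound[where B=1]) (auto simp: indicator_def)
  define \<beta> where "\<beta> A = (\<integral>y. indicator A y *\<^sub>R y \<partial>M)" for A
  have \<beta>S: "\<beta> A \<in> S" if "A \<in> sets borel" for A
    unfolding \<beta>_def using S int[OF that]
    by (intro integral_in_subspace) (auto simp: indicator_def subspace_0 elim!: eventually_mono)
  have inner: "\<beta> A \<bullet> u = (\<integral>y. indicator A y * (y \<bullet> u) \<partial>M)" if "A \<in> sets borel" for A u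
    unfolding \<beta>_def using int[OF that] by (simp flip: integral_inner_left)
  have intu: "integrable M (\<lambda>y. indicator A y * (y \<bullet> u))" if "A \<in> sets borel" for A u
    using integrable_inner_left[OF int[OF that], of u] by simp
  have [measurable]: "?P \<in> sets borel" "?N \<in> sets borel" by measurable
  \<comment> \<open>First moments of the distance to the hyperplane on its two sides. They are
    positive because both sides have positive mass.\<close>
  define p where "p = \<beta> ?P \<bullet> b - r * m"
  define q where "q = r * m - \<beta> ?N \<bullet> b"
  have p: "0 < p"
  proof -
    have "p = (\<integral>y. indicator ?P y * (y \<bullet> b - r) \<partial>M)"
      using intu[of ?P b] int1[of ?P] m
      by (simp add: p_def inner right_diff_distrib measure_def flip: mult.commute[of r])
    moreover have "0 \<le> (\<integral>y. indicator ?P y * (y \<bullet> b - r) \<partial>M)"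
      by (intro Bochner_Integration.integral_nonneg) (auto simp: indicator_def)
    moreover have "(\<integral>y. indicator ?P y * (y \<bullet> b - r) \<partial>M) \<noteq> 0"
    proof
      assume "(\<integral>y. indicator ?P y * (y \<bullet> b - r) \<partial>M) = 0"
      then have "AE y in M. indicator ?P y * (y \<bullet> b - r) = 0"
        using intu[of ?P b] int1[of ?P]
        by (subst (asm) integral_nonneg_eq_0_iff_AE) (auto simp: indicator_def right_diff_distrib)
      then have "AE y in M. y \<notin> ?P"
        by (auto simp: indicator_def elim!: eventually_mono split: if_splits)
      then have "measure M ?P = measure M {}"
        by (intro measure_eq_AE) auto
      then show False using m by simp
    qed
    ultimately show ?thesis by simp
  qed
  have q: "0 < q"
  proof -
    have "q = (\<integral>y. indicator ?N y * (r - y \<bullet> b) \<partial>M)"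
      using intu[of ?N b] int1[of ?N] m
      by (simp add: q_def inner right_diff_distrib measure_def flip: mult.commute[of r])
    moreover have "0 \<le> (\<integral>y. indicator ?N y * (r - y \<bullet> b) \<partial>M)"
      by (intro Bochner_Integration.integral_nonneg) (auto simp: indicator_def)
    moreover have "(\<integral>y. indicator ?N y * (r - y \<bullet> b) \<partial>M) \<noteq> 0"
    proof
      assume "(\<integral>y. indicator ?N y * (r - y \<bullet> b) \<partial>M) = 0"
      then have "AE y in M. indicator ?N y * (r - y \<bullet> b) = 0"
        using intu[of ?N b] int1[of ?N]
        by (subst (asm) integral_nonneg_eq_0_iff_AE) (auto simp: indicator_def right_diff_distrib)
      then have "AE y in M. y \<notin> ?N"
        by (auto simp: indicator_def elim!: eventually_mono split: if_splits)
      then have "measure M ?N = measure M {}"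
        by (intro measure_eq_AE) auto
      then show False using m by simp
    qed
    ultimately show ?thesis by simp
  qed
  \<comment> \<open>The unnormalized barycenters lie at heights \<open>p + r * m\<close> and
    \<open>r * m - q\<close> along \<open>b\<close>. This fixes the scale of \<open>d\<close>
    through \<open>d \<bullet> b = 1\<close>, and the weights \<open>q\<close> and \<open>p\<close>
    in \<open>z\<close>, a convex combination of the barycenters at height \<open>r\<close>.\<close>
  define d where "d = (1 / (p + q)) *\<^sub>R (\<beta> ?P - \<beta> ?N)"
  define z where "z = (1 / (m * (p + q))) *\<^sub>R (q *\<^sub>R \<beta> ?P + p *\<^sub>R \<beta> ?N)"
  have pq: "p + q \<noteq> 0" "m \<noteq> 0" using p q m by auto
  have db: "d \<bullet> b = 1"
    using pq by (simp add: d_def inner_diff_left p_def q_def)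
  have \<beta>b: "\<beta> ?P \<bullet> b = p + r * m" "\<beta> ?N \<bullet> b = r * m - q"
    by (simp_all add: p_def q_def)
  have zb: "z \<bullet> b = r"
  proof -
    have "q * (p + r * m) + p * (r * m - q) = r * (m * (p + q))"
      by (simp add: algebra_simps)
    then show ?thesis
      using pq by (simp add: z_def inner_add_left \<beta>b)
  qed
  have mz: "m *\<^sub>R z = (1 / (p + q)) *\<^sub>R (q *\<^sub>R \<beta> ?P + p *\<^sub>R \<beta> ?N)"
    using pq by (simp add: z_def)
  have one: "\<beta> ?P = (1 / (p + q)) *\<^sub>R ((p + q) *\<^sub>R \<beta> ?P)" "\<beta> ?N = (1 / (p + q)) *\<^sub>R ((p + q) *\<^sub>R \<beta> ?N)"
    using pq by simp_all
  have bP: "\<beta> ?P - m *\<^sub>R z = p *\<^sub>R d"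
    unfolding mz by (subst one(1)) (simp add: d_def algebra_simps)
  have bN: "\<beta> ?N - m *\<^sub>R z = - q *\<^sub>R d"
    unfolding mz by (subst one(2)) (simp add: d_def algebra_simps)
  have zero: "(\<integral>y. indicator A y * (\<zeta> \<bullet> (y - z - ((y - z) \<bullet> b) *\<^sub>R d)) \<partial>M) = 0"
    if A: "A \<in> sets borel" "measure M A = m" "\<beta> A - m *\<^sub>R z = k *\<^sub>R d" for A k \<zeta>
  proof -
    \<comment> \<open>The projection along \<open>d\<close> is transferred to
      \<open>\<zeta>\<close>. Since \<open>d \<bullet> b = 1\<close>, the vector \<open>?u\<close>
      is orthogonal to \<open>d\<close>, the direction in which the barycenter is displaced from
      \<open>z\<close>.\<close>
    let ?u = "\<zeta> - (\<zeta> \<bullet> d) *\<^sub>R b"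
    have "\<zeta> \<bullet> (y - z - ((y - z) \<bullet> b) *\<^sub>R d) = y \<bullet> ?u - z \<bullet> ?u" for y
      by (simp add: inner_diff_left inner_diff_right inner_commute algebra_simps)
    then have "(\<integral>y. indicator A y * (\<zeta> \<bullet> (y - z - ((y - z) \<bullet> b) *\<^sub>R d)) \<partial>M)
      = (\<integral>y. indicator A y * (y \<bullet> ?u) - indicator A y * (z \<bullet> ?u) \<partial>M)"
      by (simp only: right_diff_distrib)
    also have "\<dots> = (\<integral>y. indicator A y * (y \<bullet> ?u) \<partial>M) - (\<integral>y. indicator A y * (z \<bullet> ?u) \<partial>M)"
      using intu[OF A(1)] int1[OF A(1)] by (intro Bochner_Integration.integral_diff) auto
    also have "\<dots> = \<beta> A \<bullet> ?u - m * (z \<bullet> ?u)"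
      using A by (simp add: inner)
    also have "\<dots> = (\<beta> A - m *\<^sub>R z) \<bullet> ?u"
      by (simp add: inner_diff_left)
    also have "\<dots> = 0"
      unfolding A(3) using db by (simp add: inner_diff_right inner_commute)
    finally show ?thesis .
  qed
  show ?thesis
  proof (rule that[of z d])
    show "z \<in> S" "d \<in> S"
      unfolding z_def d_def using S \<beta>S[of ?P] \<beta>S[of ?N]
      by (auto intro!: subspace_scale subspace_add subspace_diff)
  qed (use db zb zero[of ?P p] zero[of ?N "- q"] m bP bN in auto)
qed

text \<open>From \<open>exp l \<ge> 1 + l\<close>, where the linear term integrates to zero. This
  converts vanishing first moments into the exponential form of centering used by the
  induction.\<close>

lemma emeasure_le_nn_integral_exp:
  assumes "finite_measure M" and [measurable]: "l \<in> borel_measurable M" "A \<in> sets M"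
    and bound: "AE x in M. x \<in> A \<longrightarrow> \<bar>l x\<bar> \<le> (C::real)" and zero: "(\<integral>x. indicator A x * l x \<partial>M) = 0"
  shows "emeasure M A \<le> (\<integral>\<^sup>+x. indicator A x * ennreal (exp (l x)) \<partial>M)"
proof -
  interpret finite_measure M by fact
  have i1: "integrable M (\<lambda>x. indicator A x * l x)"
    using bound by (intro integrable_const_bound[where B="\<bar>C\<bar>"]) (auto simp: indicator_def elim!: eventually_mono)
  have i2: "integrable M (\<lambda>x. indicator A x :: real)"
    by (intro integrable_const_bound[where B=1]) (auto simp: indicator_def)
  have i3: "integrable M (\<lambda>x. indicator A x * exp (l x))"
    using bound by (intro integrable_const_bound[where B="exp \<bar>C\<bar>"]) (auto simp: indicator_def elim!: eventually_mono)
  have "measure M A = (\<integral>x. indicator A x \<partial>M) + (\<integral>x. indicator A x * l x \<partial>M)"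
    by (simp add: zero)
  also have "\<dots> = (\<integral>x. indicator A x + indicator A x * l x \<partial>M)"
    using i1 i2 by simp
  also have "\<dots> \<le> (\<integral>x. indicator A x * exp (l x) \<partial>M)"
    using i1 i2 i3 by (intro integral_mono) (auto simp: indicator_def exp_ge_add_one_self)
  finally have "ennreal (measure M A) \<le> ennreal (\<integral>x. indicator A x * exp (l x) \<partial>M)"
    by (rule ennreal_leI)
  also have "\<dots> = (\<integral>\<^sup>+x. ennreal (indicator A x * exp (l x)) \<partial>M)"
    using i3 by (intro nn_integral_eq_integral[symmetric]) (auto simp: indicator_def)
  also have "\<dots> = (\<integral>\<^sup>+x. indicator A x * ennreal (exp (l x)) \<partial>M)"
    by (intro nn_integral_cong) (auto simp: indicator_def)
  finally show ?thesis by (simp add: emeasure_eq_measure)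
qed

text \<open>Allows the half-space opposite to \<open>b\<close> to be handled as the positive
  half-space of \<open>- b\<close>.\<close>

lemma orthonormal_insert_minus:
  fixes B :: "'a::euclidean_space set"
  assumes B: "orthonormal (insert b B)" "b \<notin> B"
  shows "orthonormal (insert (- b) B)" "- b \<notin> B" "span (insert (- b) B) = span (insert b B)"
    "f \<in> borel_measurable borel \<Longrightarrow>
      (\<integral>\<^sup>+x. f x \<partial>span_measure (insert (- b) B)) = (\<integral>\<^sup>+x. f x \<partial>span_measure (insert b B))"
proof -
  note b = orthonormal_insertD[OF B]
  show nb: "- b \<notin> B"
    using b(3) b(4)[of "- b"] by (auto intro: span_base)
  show on: "orthonormal (insert (- b) B)"
    using B nb by (auto simp: orthonormal_def pairwise_insert orthogonal_def)
  show "span (insert (- b) B) = span (insert b B)"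
  proof -
    have "- b \<in> span (insert b B)" "b \<in> span (insert (- b) B)"
      by (auto intro: span_neg span_base) (metis insertI1 minus_minus span_base span_neg)
    then show ?thesis
      by (intro span_eq[THEN iffD2]) (auto intro: span_base)
  qed
  assume [measurable]: "f \<in> borel_measurable borel"
  have "(\<integral>\<^sup>+t. f (x + t *\<^sub>R - b) \<partial>lborel) = (\<integral>\<^sup>+t. f (x + t *\<^sub>R b) \<partial>lborel)" for x
    by (subst nn_integral_real_affine[where c="-1" and t=0]) auto
  then show "(\<integral>\<^sup>+x. f x \<partial>span_measure (insert (- b) B)) = (\<integral>\<^sup>+x. f x \<partial>span_measure (insert b B))"
    using orthonormal_finite[OF b(1)] B nb by (simp add: nn_integral_span_measure_insert)
qed

section \<open>The induction step of the functional inequality\<close>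

text \<open>For fixed \<open>t\<close> the point \<open>y + t *\<^sub>R (w + b)\<close> differs from
  \<open>y + t *\<^sub>R b\<close> by a translation inside \<open>span B\<close>, so the shear
  preserves measure. The argument of \<open>k\<close> on the right recovers the sheared coordinate
  \<open>y\<close>.\<close>

lemma nn_integral_span_measure_shear:
  fixes B :: "'a::euclidean_space set"
  assumes B: "orthonormal (insert b B)" "b \<notin> B" and w: "w \<in> span B"
    and [measurable]: "g \<in> borel_measurable borel" "k \<in> borel_measurable borel"
  shows "(\<integral>\<^sup>+y. (\<integral>\<^sup>+t. indicator {0<..} t * (g (y + t *\<^sub>R (w + b)) * k y) \<partial>lborel) \<partial>span_measure B)
    = (\<integral>\<^sup>+y. indicator {y. 0 < y \<bullet> b} y * (g y * k (y - (y \<bullet> b) *\<^sub>R (w + b))) \<partial>span_measure (insert b B))"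
proof -
  note b = orthonormal_insertD[OF B]
  have sf: "sigma_finite_measure (lborel :: real measure)" by standard
  have "(\<integral>\<^sup>+y. (\<integral>\<^sup>+t. indicator {0<..} t * (g (y + t *\<^sub>R (w + b)) * k y) \<partial>lborel) \<partial>span_measure B)
    = (\<integral>\<^sup>+t. (\<integral>\<^sup>+y. indicator {0<..} t * (g ((y + t *\<^sub>R w) + t *\<^sub>R b) * k ((y + t *\<^sub>R w) - t *\<^sub>R w)) \<partial>span_measure B) \<partial>lborel)"
    by (subst nn_integral_span_measure_swap[OF b(1) sf]) (simp_all add: algebra_simps)
  also have "\<dots> = (\<integral>\<^sup>+t. (\<integral>\<^sup>+y. indicator {0<..} t * (g (y + t *\<^sub>R b) * k (y - t *\<^sub>R w)) \<partial>span_measure B) \<partial>lborel)"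
  proof (rule nn_integral_cong)
    fix t :: real
    show "(\<integral>\<^sup>+y. indicator {0<..} t * (g ((y + t *\<^sub>R w) + t *\<^sub>R b) * k ((y + t *\<^sub>R w) - t *\<^sub>R w)) \<partial>span_measure B)
      = (\<integral>\<^sup>+y. indicator {0<..} t * (g (y + t *\<^sub>R b) * k (y - t *\<^sub>R w)) \<partial>span_measure B)"
      by (rule nn_integral_span_measure_translate[OF b(1) span_scale[OF w],
            of "\<lambda>y. indicator {0<..} t * (g (y + t *\<^sub>R b) * k (y - t *\<^sub>R w))"]) measurable
  qed
  also have "\<dots> = (\<integral>\<^sup>+y. (\<integral>\<^sup>+t. indicator {0<..} t * (g (y + t *\<^sub>R b) * k (y - t *\<^sub>R w)) \<partial>lborel) \<partial>span_measure B)"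
    by (subst nn_integral_span_measure_swap[OF b(1) sf]) simp_all
  also have "\<dots> = (\<integral>\<^sup>+y. indicator {y. 0 < y \<bullet> b} y * (g y * k (y - (y \<bullet> b) *\<^sub>R (w + b))) \<partial>span_measure (insert b B))"
  proof (subst nn_integral_span_measure_insert[OF orthonormal_finite[OF b(1)] B(2)], measurable,
      rule nn_integral_span_measure_cong)
    fix y assume "y \<in> span B"
    then have "(y + t *\<^sub>R b) \<bullet> b = t" for t
      using b(3,4) by (simp add: inner_add_left)
    then show "(\<integral>\<^sup>+t. indicator {0<..} t * (g (y + t *\<^sub>R b) * k (y - t *\<^sub>R w)) \<partial>lborel)
      = (\<integral>\<^sup>+t. indicator {y. 0 < y \<bullet> b} (y + t *\<^sub>R b) *
          (g (y + t *\<^sub>R b) * k (y + t *\<^sub>R b - ((y + t *\<^sub>R b) \<bullet> b) *\<^sub>R (w + b))) \<partial>lborel)"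
      by (intro nn_integral_cong) (simp add: indicator_def scaleR_add_right)
  qed
  finally show ?thesis .
qed

text \<open>Put \<open>d = w + b\<close>. Points of the half-space of \<open>b\<close> are written
  \<open>y + t *\<^sub>R d\<close>, and points of the half-space of \<open>d\<close> are written
  \<open>x + (s - w \<bullet> x) *\<^sub>R b\<close>, where \<open>s\<close> is the inner product
  with \<open>d\<close>. In these dual coordinates the pairing is
  \<open>x \<bullet> y + s * t\<close>. Prekopa--Leindler in \<open>s\<close> and \<open>t\<close>
  therefore bounds the product of the two marginals by \<open>exp (- (x \<bullet> y))\<close> times
  \<open>pi / 2\<close>, the squared integral of \<open>gauss\<close> over the half-line, and the
  induction hypothesis applies to the marginals.\<close>

lemma functional_santalo_half_step:
  fixes B :: "'a::euclidean_space set"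
  assumes B: "orthonormal (insert b B)" "b \<notin> B" and w: "w \<in> span B"
    and IH: "\<And>f g :: 'a \<Rightarrow> ennreal. f \<in> borel_measurable borel \<Longrightarrow> g \<in> borel_measurable borel \<Longrightarrow>
      (\<And>\<zeta>. \<zeta> \<in> span B \<Longrightarrow> (\<integral>\<^sup>+x. f x \<partial>span_measure B) \<le> (\<integral>\<^sup>+x. f x * ennreal (exp (\<zeta> \<bullet> x)) \<partial>span_measure B)) \<Longrightarrow>
      (\<And>x y. x \<in> span B \<Longrightarrow> y \<in> span B \<Longrightarrow> f x * g y \<le> ennreal (exp (- (x \<bullet> y)))) \<Longrightarrow>
      (\<integral>\<^sup>+x. f x \<partial>span_measure B) * (\<integral>\<^sup>+x. g x \<partial>span_measure B) \<le> ennreal ((2 * pi) ^ card B)"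
    and [measurable]: "f \<in> borel_measurable borel" "g \<in> borel_measurable borel"
    and cent: "\<And>\<zeta>. \<zeta> \<in> span B \<Longrightarrow>
      (\<integral>\<^sup>+y. indicator {y. 0 < y \<bullet> b} y * g y \<partial>span_measure (insert b B))
      \<le> (\<integral>\<^sup>+y. indicator {y. 0 < y \<bullet> b} y * (g y * ennreal (exp (\<zeta> \<bullet> (y - (y \<bullet> b) *\<^sub>R (w + b))))) \<partial>span_measure (insert b B))"
    and le: "\<And>x y. x \<in> span (insert b B) \<Longrightarrow> y \<in> span (insert b B) \<Longrightarrow> f x * g y \<le> ennreal (exp (- (x \<bullet> y)))"
  shows "(\<integral>\<^sup>+x. (\<integral>\<^sup>+s. indicator {0<..} s * f (x + (s - w \<bullet> x) *\<^sub>R b) \<partial>lborel) \<partial>span_measure B)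
      * (\<integral>\<^sup>+y. indicator {y. 0 < y \<bullet> b} y * g y \<partial>span_measure (insert b B))
    \<le> ennreal (pi / 2 * (2 * pi) ^ card B)"
proof -
  note b = orthonormal_insertD[OF B]
  define F where "F x = (\<integral>\<^sup>+s. indicator {0<..} s * f (x + (s - w \<bullet> x) *\<^sub>R b) \<partial>lborel)" for x
  define G where "G y = (\<integral>\<^sup>+t. indicator {0<..} t * g (y + t *\<^sub>R (w + b)) \<partial>lborel)" for y
  have [measurable]: "F \<in> borel_measurable borel" "G \<in> borel_measurable borel"
    unfolding F_def G_def by measurable
  have Gk: "(\<integral>\<^sup>+y. G y * k y \<partial>span_measure B)
    = (\<integral>\<^sup>+y. indicator {y. 0 < y \<bullet> b} y * (g y * k (y - (y \<bullet> b) *\<^sub>R (w + b))) \<partial>span_measure (insert b B))"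
    if [measurable]: "k \<in> borel_measurable borel" for k
    using nn_integral_span_measure_shear[OF B w, of g k]
    by (simp add: G_def nn_integral_multc[symmetric] mult.assoc)
  have G1: "(\<integral>\<^sup>+y. G y \<partial>span_measure B) = (\<integral>\<^sup>+y. indicator {y. 0 < y \<bullet> b} y * g y \<partial>span_measure (insert b B))"
    using Gk[of "\<lambda>_. 1"] by simp
  have span: "x + t *\<^sub>R b \<in> span (insert b B)" if "x \<in> span B" for x t
    using that by (intro span_add span_scale span_base[of b]) (auto intro: span_mono[THEN subsetD, of B])
  have FG: "F x * G y \<le> ennreal (exp (- (x \<bullet> y)) * (pi / 2))" if xy: "x \<in> span B" "y \<in> span B" for x y
  proof -
    \<comment> \<open>Half the exponent, because the bound enters squared.\<close>
    let ?e = "ennreal (exp (- (x \<bullet> y) / 2))"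
    have "F x * G y \<le> (\<integral>\<^sup>+u. indicator {0<..} u * (?e * gauss (u::real)) \<partial>lborel)\<^sup>2"
      unfolding F_def G_def
    proof (rule prekopa_leindler_mult)
      fix s t :: real assume st: "0 < s" "0 < t"
      have *: "y + t *\<^sub>R w \<in> span B" using xy w by (intro span_add span_scale)
      have "f (x + (s - w \<bullet> x) *\<^sub>R b) * g ((y + t *\<^sub>R w) + t *\<^sub>R b)
        \<le> ennreal (exp (- ((x + (s - w \<bullet> x) *\<^sub>R b) \<bullet> ((y + t *\<^sub>R w) + t *\<^sub>R b))))"
        using xy * by (intro le span)
      also have "(x + (s - w \<bullet> x) *\<^sub>R b) \<bullet> ((y + t *\<^sub>R w) + t *\<^sub>R b) = x \<bullet> y + s * t"
        using b(3) b(4)[OF xy(1)] b(4)[OF xy(2)] b(4)[OF w]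
        by (simp add: inner_add_left inner_add_right inner_commute algebra_simps)
      also have "ennreal (exp (- (x \<bullet> y + s * t))) = (?e * gauss (sqrt (s * t)))\<^sup>2"
        using st by (simp add: gauss_def ennreal_power power2_eq_square add_divide_distrib flip: ennreal_mult exp_add)
      finally show "f (x + (s - w \<bullet> x) *\<^sub>R b) * g (y + t *\<^sub>R (w + b)) \<le> (?e * gauss (sqrt (s * t)))\<^sup>2"
        by (simp add: algebra_simps)
    qed measurable
    also have "(\<integral>\<^sup>+u. indicator {0<..} u * (?e * gauss (u::real)) \<partial>lborel) = ?e * ennreal (sqrt (pi / 2))"
      by (simp only: mult.left_commute[of _ ?e])
        (simp add: nn_integral_cmult nn_integral_gauss_half del: mult_minus_left minus_divide_left)
    also have "(?e * ennreal (sqrt (pi / 2)))\<^sup>2 = ennreal (exp (- (x \<bullet> y)) * (pi / 2))"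
    proof -
      have "(exp (- (x \<bullet> y) / 2) * sqrt (pi / 2))\<^sup>2 = exp (- (x \<bullet> y)) * (pi / 2)"
        by (simp add: power_mult_distrib) (simp add: power2_eq_square flip: exp_add)
      then show ?thesis
        by (simp add: ennreal_power flip: ennreal_mult)
    qed
    finally show ?thesis .
  qed
  have pi2: "ennreal (pi / 2) * ennreal (2 / pi) = 1"
    by (simp flip: ennreal_mult)
  \<comment> \<open>The roles are exchanged: the marginal \<open>G\<close> of \<open>g\<close> takes
    the place of the centered function, and \<open>F\<close> absorbs the constant
    \<open>pi / 2\<close>.\<close>
  have "(\<integral>\<^sup>+y. G y \<partial>span_measure B) * (\<integral>\<^sup>+x. F x * ennreal (2 / pi) \<partial>span_measure B) \<le> ennreal ((2 * pi) ^ card B)"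
  proof (rule IH)
    show "(\<integral>\<^sup>+y. G y \<partial>span_measure B) \<le> (\<integral>\<^sup>+y. G y * ennreal (exp (\<zeta> \<bullet> y)) \<partial>span_measure B)"
      if "\<zeta> \<in> span B" for \<zeta>
      using cent[OF that] unfolding G1 by (subst Gk) simp_all
    show "G y * (F x * ennreal (2 / pi)) \<le> ennreal (exp (- (y \<bullet> x)))" if "y \<in> span B" "x \<in> span B" for x y
    proof -
      have "G y * (F x * ennreal (2 / pi)) = F x * G y * ennreal (2 / pi)"
        by (simp add: ac_simps)
      also have "\<dots> \<le> ennreal (exp (- (x \<bullet> y)) * (pi / 2)) * ennreal (2 / pi)"
        by (intro mult_right_mono FG that) simp
      also have "\<dots> = ennreal (exp (- (y \<bullet> x)))"
        by (simp add: inner_commute flip: ennreal_mult)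
      finally show ?thesis .
    qed
  qed measurable
  then have "ennreal (pi / 2) * ((\<integral>\<^sup>+y. G y \<partial>span_measure B) * (\<integral>\<^sup>+x. F x * ennreal (2 / pi) \<partial>span_measure B))
    \<le> ennreal (pi / 2) * ennreal ((2 * pi) ^ card B)"
    by (intro mult_left_mono) simp_all
  also have "ennreal (pi / 2) * ((\<integral>\<^sup>+y. G y \<partial>span_measure B) * (\<integral>\<^sup>+x. F x * ennreal (2 / pi) \<partial>span_measure B))
    = (ennreal (pi / 2) * ennreal (2 / pi)) * ((\<integral>\<^sup>+x. F x \<partial>span_measure B) * (\<integral>\<^sup>+y. G y \<partial>span_measure B))"
  proof -
    have "(\<integral>\<^sup>+x. F x * ennreal (2 / pi) \<partial>span_measure B) = (\<integral>\<^sup>+x. F x \<partial>span_measure B) * ennreal (2 / pi)"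
      by (rule nn_integral_multc) measurable
    then show ?thesis by (simp only: ac_simps)
  qed
  finally show ?thesis
    unfolding pi2 G1 unfolding F_def by (subst ennreal_mult) simp_all
qed

text \<open>Boundedness and bounded support of \<open>g\<close> make it the density of a finite
  measure that has barycenters and satisfies a strip estimate, so that it can be halved.\<close>

lemma functional_santalo_bounded_step:
  fixes B :: "'a::euclidean_space set"
  assumes B: "orthonormal (insert b B)" "b \<notin> B"
    and IH: "\<And>f g :: 'a \<Rightarrow> ennreal. f \<in> borel_measurable borel \<Longrightarrow> g \<in> borel_measurable borel \<Longrightarrow>
      (\<And>\<zeta>. \<zeta> \<in> span B \<Longrightarrow> (\<integral>\<^sup>+x. f x \<partial>span_measure B) \<le> (\<integral>\<^sup>+x. f x * ennreal (exp (\<zeta> \<bullet> x)) \<partial>span_measure B)) \<Longrightarrow>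
      (\<And>x y. x \<in> span B \<Longrightarrow> y \<in> span B \<Longrightarrow> f x * g y \<le> ennreal (exp (- (x \<bullet> y)))) \<Longrightarrow>
      (\<integral>\<^sup>+x. f x \<partial>span_measure B) * (\<integral>\<^sup>+x. g x \<partial>span_measure B) \<le> ennreal ((2 * pi) ^ card B)"
    and [measurable]: "f \<in> borel_measurable borel" "g \<in> borel_measurable borel"
    and cent: "\<And>\<zeta>. \<zeta> \<in> span (insert b B) \<Longrightarrow>
      (\<integral>\<^sup>+x. f x \<partial>span_measure (insert b B)) \<le> (\<integral>\<^sup>+x. f x * ennreal (exp (\<zeta> \<bullet> x)) \<partial>span_measure (insert b B))"
    and le: "\<And>x y. x \<in> span (insert b B) \<Longrightarrow> y \<in> span (insert b B) \<Longrightarrow> f x * g y \<le> ennreal (exp (- (x \<bullet> y)))"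
    and R: "0 \<le> R" "\<And>y. g y \<le> ennreal R" "\<And>y. g y \<noteq> 0 \<Longrightarrow> norm y \<le> R"
  shows "(\<integral>\<^sup>+x. f x \<partial>span_measure (insert b B)) * (\<integral>\<^sup>+x. g x \<partial>span_measure (insert b B)) \<le> ennreal ((2 * pi) ^ Suc (card B))"
proof (cases "(\<integral>\<^sup>+x. g x \<partial>span_measure (insert b B)) = 0")
  case False
  note b = orthonormal_insertD[OF B]
  note fin = orthonormal_finite[OF b(1)]
  define L where "L = span_measure (insert b B)"
  define S where "S = span (insert b B)"
  define M where "M = density L g"
  have [measurable]: "cball (0 :: 'a) R \<in> sets borel"
    by simp
  have L[measurable_cong, simp]: "sets L = sets borel" "space L = UNIV"
    by (simp_all add: L_def)
  have M[measurable_cong, simp]: "sets M = sets borel" "space M = UNIV"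
    by (simp_all add: M_def)
  have emM: "emeasure M A = (\<integral>\<^sup>+y. indicator A y * g y \<partial>L)" if "A \<in> sets borel" for A
    using that by (simp add: M_def emeasure_density mult.commute)
  have g_le: "g y \<le> ennreal R * indicator (cball 0 R) y" for y
    using R(2,3)[of y] by (cases "g y = 0") (auto simp: indicator_def)
  have "emeasure M (space M) \<le> (\<integral>\<^sup>+y. ennreal R * indicator (cball 0 R) y \<partial>L)"
    by (simp add: emM g_le nn_integral_mono)
  also have "\<dots> = ennreal R * emeasure L (cball 0 R)"
    by (rule nn_integral_cmult_indicator) simp
  also have "\<dots> < \<infinity>"
    using emeasure_span_measure_cball_finite[OF B(1), of R] by (simp add: L_def ennreal_mult_less_top)
  finally have finM: "finite_measure M"
    by (intro finite_measureI) auto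
  interpret finite_measure M by fact
  have AEg: "AE y in M. norm y \<le> R"
    unfolding M_def using R(3) by (subst AE_density) (auto simp: less_le)
  have AES: "AE y in M. y \<in> S"
    unfolding M_def S_def L_def using AE_span_measure[of "insert b B"] by (subst AE_density) auto
  \<comment> \<open>A slab of width \<open>t - s\<close> inside the ball of radius \<open>R\<close>
    projects into the ball of one dimension less, and the density is at most \<open>R\<close>; the
    same number bounds radius and density.\<close>
  define C where "C = R * measure (span_measure B) (cball 0 R)"
  have strip: "measure M {y\<in>space M. s < y \<bullet> b \<and> y \<bullet> b \<le> t} \<le> C * (t - s)" if st: "s \<le> t" for s t
  proof -
    have "emeasure M {y. s < y \<bullet> b \<and> y \<bullet> b \<le> t}
      = (\<integral>\<^sup>+x. (\<integral>\<^sup>+\<tau>. indicator {y. s < y \<bullet> b \<and> y \<bullet> b \<le> t} (x + \<tau> *\<^sub>R b) * g (x + \<tau> *\<^sub>R b) \<partial>lborel) \<partial>span_measure B)"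
      unfolding L_def by (subst emM, measurable, unfold L_def, rule nn_integral_span_measure_insert[OF fin B(2)]) measurable
    also have "\<dots> \<le> (\<integral>\<^sup>+x. ennreal R * indicator (cball 0 R) x * ennreal (t - s) \<partial>span_measure B)"
    proof (rule nn_integral_span_measure_mono)
      fix x assume x: "x \<in> span B"
      have "(\<integral>\<^sup>+\<tau>. indicator {y. s < y \<bullet> b \<and> y \<bullet> b \<le> t} (x + \<tau> *\<^sub>R b) * g (x + \<tau> *\<^sub>R b) \<partial>lborel)
        \<le> (\<integral>\<^sup>+\<tau>. ennreal R * indicator (cball 0 R) x * indicator {s<..t} \<tau> \<partial>lborel)"
      proof (rule nn_integral_mono)
        fix \<tau>
        have "(x + \<tau> *\<^sub>R b) \<bullet> b = \<tau>"
          using b x by (simp add: inner_add_left)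
        moreover have "g (x + \<tau> *\<^sub>R b) \<le> ennreal R * indicator (cball 0 R) x"
        proof (cases "g (x + \<tau> *\<^sub>R b) = 0")
          case False
          then have "sqrt ((norm x)\<^sup>2 + \<tau>\<^sup>2) \<le> R"
            using R(3) b x by (simp flip: norm_add_orthogonal_unit[of x b])
          then have "norm x \<le> R"
            using order_trans[OF real_sqrt_le_mono[of "(norm x)\<^sup>2" "(norm x)\<^sup>2 + \<tau>\<^sup>2"]] by simp
          then show ?thesis using R(2) by simp
        qed simp
        ultimately show "indicator {y. s < y \<bullet> b \<and> y \<bullet> b \<le> t} (x + \<tau> *\<^sub>R b) * g (x + \<tau> *\<^sub>R b)
          \<le> ennreal R * indicator (cball 0 R) x * indicator {s<..t} \<tau>"
          by (simp add: indicator_def)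
      qed
      also have "\<dots> = ennreal R * indicator (cball 0 R) x * ennreal (t - s)"
        using st by (simp add: nn_integral_cmult_indicator)
      finally show "(\<integral>\<^sup>+\<tau>. indicator {y. s < y \<bullet> b \<and> y \<bullet> b \<le> t} (x + \<tau> *\<^sub>R b) * g (x + \<tau> *\<^sub>R b) \<partial>lborel)
        \<le> ennreal R * indicator (cball 0 R) x * ennreal (t - s)" .
    qed
    also have "\<dots> = (\<integral>\<^sup>+x. ennreal R * indicator (cball 0 R) x \<partial>span_measure B) * ennreal (t - s)"
      by (rule nn_integral_multc) measurable
    also have "(\<integral>\<^sup>+x. ennreal R * indicator (cball 0 R) x \<partial>span_measure B) = ennreal R * emeasure (span_measure B) (cball 0 R)"
      by (rule nn_integral_cmult_indicator) simp
    also have "ennreal R * emeasure (span_measure B) (cball 0 R) * ennreal (t - s) = ennreal (C * (t - s))"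
      using emeasure_span_measure_cball_finite[OF b(1), of R] R(1) st
      by (simp add: C_def ennreal_mult emeasure_eq_ennreal_measure less_top)
    finally show ?thesis
      using st R(1) by (simp add: emeasure_eq_measure C_def)
  qed
  have bd: "AE y in M. \<bar>y \<bullet> b\<bar> \<le> R"
    using AEg by eventually_elim (use Cauchy_Schwarz_ineq2[of _ b] b(2) in \<open>auto intro: order_trans\<close>)
  obtain r where r: "measure M {y. r < y \<bullet> b} = measure M UNIV / 2" "measure M {y. y \<bullet> b < r} = measure M UNIV / 2"
    using finite_measure_halving[OF finM _ strip bd] by auto
  define m where "m = measure M UNIV / 2"
  have g2m: "(\<integral>\<^sup>+x. g x \<partial>L) = ennreal (2 * m)"
    using emM[of UNIV] by (simp add: m_def emeasure_eq_measure)
  have m: "0 < m"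
    using False g2m measure_nonneg[of M UNIV] by (auto simp: L_def m_def less_le)
  obtain z d where zd: "z \<in> S" "d \<in> S" "z \<bullet> b = r" "d \<bullet> b = 1"
    and P0: "\<And>\<zeta>. (\<integral>y. indicator {y. r < y \<bullet> b} y * (\<zeta> \<bullet> (y - z - ((y - z) \<bullet> b) *\<^sub>R d)) \<partial>M) = 0"
    and N0: "\<And>\<zeta>. (\<integral>y. indicator {y. y \<bullet> b < r} y * (\<zeta> \<bullet> (y - z - ((y - z) \<bullet> b) *\<^sub>R d)) \<partial>M) = 0"
    by (rule halves_barycenter_axis[OF finM M(1) _ AES AEg, of r b m])
       (use r m in \<open>auto simp: m_def S_def subspace_span\<close>)
  \<comment> \<open>The axis direction is \<open>b\<close> plus a vector of \<open>span B\<close>,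
    because \<open>d \<bullet> b = 1\<close>.\<close>
  define w where "w = d - b"
  have w: "w \<in> span B"
  proof -
    have "w \<in> span (insert b B)"
      using zd(2) by (auto simp: w_def S_def intro!: span_diff intro: span_base)
    then obtain k where k: "w - k *\<^sub>R b \<in> span B"
      by (auto simp: span_insert)
    moreover have "w \<bullet> b = 0"
      using zd b by (simp add: w_def inner_diff_left)
    ultimately have "k = 0"
      using b(4)[OF k] b(3) by (simp add: inner_diff_left)
    with k show ?thesis by simp
  qed
  have wb: "w + b = d" by (simp add: w_def)
  have trans: "(\<integral>\<^sup>+y. k (y + z) \<partial>L) = (\<integral>\<^sup>+y. k y \<partial>L)" if "k \<in> borel_measurable borel" for k
    unfolding L_def using zd(1) that by (intro nn_integral_span_measure_translate[OF B(1)]) (simp_all add: S_def)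
  \<comment> \<open>Translation by \<open>z\<close> moves both the cutting hyperplane and the
    barycenter axis through the origin. The factor \<open>exp (z \<bullet> x)\<close> restores the
    pairing bound, and by centering it does not lower the integral of \<open>f\<close>.\<close>
  define g' where "g' y = g (y + z)" for y
  define f' where "f' x = f x * ennreal (exp (z \<bullet> x))" for x
  have meas'[measurable]: "f' \<in> borel_measurable borel" "g' \<in> borel_measurable borel"
    unfolding f'_def g'_def by measurable
  have mass: "(\<integral>\<^sup>+y. indicator A (y + z) * g' y \<partial>L) = emeasure M A" if [measurable]: "A \<in> sets borel" for A
    using trans[of "\<lambda>y. indicator A y * g y"] by (simp add: g'_def emM)
  have centg: "(\<integral>\<^sup>+y. indicator A (y + z) * g' y \<partial>L)
      \<le> (\<integral>\<^sup>+y. indicator A (y + z) * (g' y * ennreal (exp (\<zeta> \<bullet> (y - (y \<bullet> b) *\<^sub>R d)))) \<partial>L)"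
    if [measurable]: "A \<in> sets borel"
      and zero: "(\<integral>y. indicator A y * (\<zeta> \<bullet> (y - z - ((y - z) \<bullet> b) *\<^sub>R d)) \<partial>M) = 0" for A \<zeta>
  proof -
    let ?l = "\<lambda>y. \<zeta> \<bullet> (y - z - ((y - z) \<bullet> b) *\<^sub>R d)"
    have "bounded (?l ` cball 0 R)"
      by (intro compact_imp_bounded compact_continuous_image continuous_intros compact_cball)
    then obtain K where "\<forall>x\<in>?l ` cball 0 R. norm x \<le> K"
      unfolding bounded_iff by (rule exE)
    then have K: "\<bar>?l y\<bar> \<le> K" if "norm y \<le> R" for y
      using that by simp
    have "emeasure M A \<le> (\<integral>\<^sup>+y. indicator A y * ennreal (exp (?l y)) \<partial>M)"
      using AEg K by (intro emeasure_le_nn_integral_exp[OF finM _ _ _ zero, of K]) (auto elim!: eventually_mono)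
    also have "\<dots> = (\<integral>\<^sup>+y. g y * (indicator A y * ennreal (exp (?l y))) \<partial>L)"
      unfolding M_def by (rule nn_integral_density) measurable
    also have "\<dots> = (\<integral>\<^sup>+y. g (y + z) * (indicator A (y + z) * ennreal (exp (?l (y + z)))) \<partial>L)"
      by (rule trans[symmetric]) measurable
    finally show ?thesis
      unfolding mass[OF that(1)] by (simp add: g'_def ac_simps)
  qed
  have le': "f' x * g' y \<le> ennreal (exp (- (x \<bullet> y)))" if "x \<in> S" "y \<in> S" for x y
  proof -
    have "f' x * g' y = (f x * g (y + z)) * ennreal (exp (z \<bullet> x))"
      by (simp add: f'_def g'_def ac_simps)
    also have "\<dots> \<le> ennreal (exp (- (x \<bullet> (y + z)))) * ennreal (exp (z \<bullet> x))"
      using that zd by (intro mult_right_mono le) (auto simp: S_def intro: span_add)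
    also have "\<dots> = ennreal (exp (- (x \<bullet> y)))"
      by (simp add: inner_add_right inner_commute flip: ennreal_mult exp_add)
    finally show ?thesis .
  qed
  let ?c = "ennreal (pi / 2 * (2 * pi) ^ card B)"
  let ?J1 = "\<integral>\<^sup>+x. (\<integral>\<^sup>+s. indicator {0<..} s * f' (x + (s - w \<bullet> x) *\<^sub>R b) \<partial>lborel) \<partial>span_measure B"
  \<comment> \<open>The half \<open>s < 0\<close> of the same integral, rewritten with
    \<open>- b\<close> and \<open>- w\<close> so that the half-space step applies verbatim.\<close>
  let ?J2 = "\<integral>\<^sup>+x. (\<integral>\<^sup>+s. indicator {0<..} s * f' (x + (s - (- w) \<bullet> x) *\<^sub>R (- b)) \<partial>lborel) \<partial>span_measure B"
  have indP: "indicator {y. r < y \<bullet> b} (y + z) = (indicator {y. 0 < y \<bullet> b} y :: ennreal)"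
    and indN: "indicator {y. y \<bullet> b < r} (y + z) = (indicator {y. 0 < y \<bullet> (- b)} y :: ennreal)" for y
    using zd by (auto simp: indicator_def inner_add_left)
  have J1: "?J1 * ennreal m \<le> ?c"
  proof -
    have "?J1 * (\<integral>\<^sup>+y. indicator {y. 0 < y \<bullet> b} y * g' y \<partial>span_measure (insert b B)) \<le> ?c"
      using centg[of "{y. r < y \<bullet> b}", OF _ P0] le'
      by (intro functional_santalo_half_step[OF B w IH]) (simp_all add: indP wb L_def S_def)
    then show ?thesis
      using mass[of "{y. r < y \<bullet> b}"] r by (simp add: indP L_def emeasure_eq_measure m_def)
  qed
  have J2: "?J2 * ennreal m \<le> ?c"
  proof -
    note B' = orthonormal_insert_minus(1,2)[OF B]
    have "?J2 * (\<integral>\<^sup>+y. indicator {y. 0 < y \<bullet> (- b)} y * g' y \<partial>span_measure (insert (- b) B)) \<le> ?c"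
    proof (rule functional_santalo_half_step[OF B' _ IH])
      show "- w \<in> span B" using w by (rule span_neg)
      show "(\<integral>\<^sup>+y. indicator {y. 0 < y \<bullet> (- b)} y * g' y \<partial>span_measure (insert (- b) B))
        \<le> (\<integral>\<^sup>+y. indicator {y. 0 < y \<bullet> (- b)} y * (g' y * ennreal (exp (\<zeta> \<bullet> (y - (y \<bullet> (- b)) *\<^sub>R (- w + - b))))) \<partial>span_measure (insert (- b) B))"
        for \<zeta>
      proof -
        have d: "(y \<bullet> (- b)) *\<^sub>R (- w + - b) = (y \<bullet> b) *\<^sub>R d" for y
          by (simp add: w_def)
        show ?thesis
          unfolding d using centg[of "{y. y \<bullet> b < r}", OF _ N0, of \<zeta>] unfolding indN L_def
          by (subst (1 2) orthonormal_insert_minus(4)[OF B]) simp_all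
      qed
      show "f' x * g' y \<le> ennreal (exp (- (x \<bullet> y)))" if "x \<in> span (insert (- b) B)" "y \<in> span (insert (- b) B)" for x y
        using le' that orthonormal_insert_minus(3)[OF B] by (simp add: S_def)
    qed (use meas' in simp_all)
    also have "(\<integral>\<^sup>+y. indicator {y. 0 < y \<bullet> (- b)} y * g' y \<partial>span_measure (insert (- b) B)) = ennreal m"
      using mass[of "{y. y \<bullet> b < r}"] r
      by (subst orthonormal_insert_minus(4)[OF B]) (simp_all only: indN L_def emeasure_eq_measure m_def, measurable)
    finally show ?thesis .
  qed
  have "(\<integral>\<^sup>+x. f x \<partial>L) \<le> (\<integral>\<^sup>+x. f' x \<partial>L)"
    using cent[of z] zd by (simp add: L_def S_def f'_def)
  also have "\<dots> = (\<integral>\<^sup>+x. (\<integral>\<^sup>+s. f' (x + s *\<^sub>R b) \<partial>lborel) \<partial>span_measure B)"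
    unfolding L_def by (rule nn_integral_span_measure_insert[OF fin B(2)]) measurable
  \<comment> \<open>After this shift \<open>s\<close> is the inner product of the point with
    \<open>d\<close>, so its sign tells the two dual half-spaces apart.\<close>
  also have "\<dots> = (\<integral>\<^sup>+x. (\<integral>\<^sup>+s. f' (x + (s - w \<bullet> x) *\<^sub>R b) \<partial>lborel) \<partial>span_measure B)"
  proof (rule nn_integral_cong)
    fix x
    show "(\<integral>\<^sup>+s. f' (x + s *\<^sub>R b) \<partial>lborel) = (\<integral>\<^sup>+s. f' (x + (s - w \<bullet> x) *\<^sub>R b) \<partial>lborel)"
      using nn_integral_real_affine[of "\<lambda>s. f' (x + s *\<^sub>R b)" 1 "- (w \<bullet> x)"] by simp
  qed
  also have "\<dots> = ?J1 + ?J2"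
    by (subst nn_integral_lborel_split, measurable, subst nn_integral_add) (simp_all add: algebra_simps)
  finally have "(\<integral>\<^sup>+x. f x \<partial>L) * (\<integral>\<^sup>+x. g x \<partial>L) \<le> (?J1 + ?J2) * ennreal (2 * m)"
    unfolding g2m by (rule mult_right_mono) simp
  also have "\<dots> = 2 * (?J1 * ennreal m + ?J2 * ennreal m)"
    using m by (simp add: ennreal_mult distrib_left distrib_right ac_simps)
  \<comment> \<open>Four copies of \<open>pi / 2\<close> give the factor \<open>2 * pi\<close> of
    the additional dimension.\<close>
  also have "\<dots> \<le> 2 * (?c + ?c)"
    by (intro mult_left_mono add_mono J1 J2) simp
  also have "\<dots> = ennreal ((2 * pi) ^ Suc (card B))"
  proof -
    have "?c + ?c = ennreal (pi * (2 * pi) ^ card B)"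
      by (subst ennreal_plus[symmetric]) simp_all
    then have "2 * (?c + ?c) = ennreal 2 * ennreal (pi * (2 * pi) ^ card B)"
      by simp
    also have "\<dots> = ennreal (2 * (pi * (2 * pi) ^ card B))"
      by (rule ennreal_mult[symmetric]) simp_all
    finally show ?thesis by (simp add: mult.assoc)
  qed
  finally show ?thesis unfolding L_def .
qed simp

text \<open>The first hypothesis on \<open>f\<close> says that its barycenter is the origin, in a form that needs no
  integrability.\<close>

lemma functional_santalo_centered:
  fixes f g :: "'a::euclidean_space \<Rightarrow> ennreal"
  assumes "orthonormal B" "f \<in> borel_measurable borel" "g \<in> borel_measurable borel"
    and "\<And>\<zeta>. \<zeta> \<in> span B \<Longrightarrow> (\<integral>\<^sup>+x. f x \<partial>span_measure B) \<le> (\<integral>\<^sup>+x. f x * ennreal (exp (\<zeta> \<bullet> x)) \<partial>span_measure B)"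
    and "\<And>x y. x \<in> span B \<Longrightarrow> y \<in> span B \<Longrightarrow> f x * g y \<le> ennreal (exp (- (x \<bullet> y)))"
  shows "(\<integral>\<^sup>+x. f x \<partial>span_measure B) * (\<integral>\<^sup>+x. g x \<partial>span_measure B) \<le> ennreal ((2 * pi) ^ card B)"
  using assms
proof (induction B arbitrary: f g rule: orthonormal_induct)
  case empty
  then show ?case using empty.prems(4)[of 0 0] by simp
next
  case (insert b B)
  note [measurable] = insert.prems(1,2)
  let ?L = "span_measure (insert b B)"
  have [measurable]: "cball (0 :: 'a) r \<in> sets borel" for r
    by simp
  \<comment> \<open>Only \<open>g\<close> is truncated: this preserves the pairing bound, whereas
    truncating \<open>f\<close> could destroy its centering.\<close>
  define g' where "g' n y = min (g y) (of_nat n) * indicator (cball 0 (real n)) y" for n y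
  have [measurable]: "g' n \<in> borel_measurable borel" for n
    unfolding g'_def by measurable
  have g'_le: "g' n y \<le> g y" for n y
    by (simp add: g'_def indicator_def)
  have inc: "incseq g'"
    unfolding incseq_def le_fun_def g'_def
    by (intro allI impI mult_mono min.mono) (auto simp: indicator_def)
  have sup: "(SUP n. g' n y) = g y" for y
  proof (rule antisym)
    show "(SUP n. g' n y) \<le> g y" by (intro SUP_least g'_le)
    obtain k where k: "norm y \<le> real k" using real_arch_simple by blast
    have "min (g y) (of_nat n) \<le> (SUP n. g' n y)" for n
    proof -
      have "min (g y) (of_nat n) \<le> g' (max n k) y"
        using k by (auto simp: g'_def indicator_def intro!: min.coboundedI2)
      also have "\<dots> \<le> (SUP n. g' n y)" by (rule SUP_upper) simp
      finally show ?thesis .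
    qed
    then have "(SUP n. min (g y) (of_nat n)) \<le> (SUP n. g' n y)" by (rule SUP_least)
    then show "g y \<le> (SUP n. g' n y)" by (simp only: SUP_min_of_nat)
  qed
  have "(\<integral>\<^sup>+x. g x \<partial>?L) = (\<integral>\<^sup>+x. (SUP n. g' n x) \<partial>?L)"
    by (simp only: sup)
  also have "\<dots> = (SUP n. \<integral>\<^sup>+x. g' n x \<partial>?L)"
    using inc by (intro nn_integral_monotone_convergence_SUP) measurable
  finally have "(\<integral>\<^sup>+x. f x \<partial>?L) * (\<integral>\<^sup>+x. g x \<partial>?L) = (SUP n. (\<integral>\<^sup>+x. f x \<partial>?L) * (\<integral>\<^sup>+x. g' n x \<partial>?L))"
    by (simp add: SUP_mult_left_ennreal)
  also have "\<dots> \<le> ennreal ((2 * pi) ^ Suc (card B))"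
  proof (rule SUP_least)
    fix n
    show "(\<integral>\<^sup>+x. f x \<partial>?L) * (\<integral>\<^sup>+x. g' n x \<partial>?L) \<le> ennreal ((2 * pi) ^ Suc (card B))"
    proof (rule functional_santalo_bounded_step[OF insert.hyps(1,2) insert.IH])
      show "g' n y \<le> ennreal (real n)" for y
        by (simp add: g'_def indicator_def ennreal_of_nat_eq_real_of_nat)
      show "norm y \<le> real n" if "g' n y \<noteq> 0" for y
        using that by (auto simp: g'_def indicator_def split: if_splits)
      show "f x * g' n y \<le> ennreal (exp (- (x \<bullet> y)))" if "x \<in> span (insert b B)" "y \<in> span (insert b B)" for x y
        using order_trans[OF mult_left_mono[OF g'_le] insert.prems(4)[OF that]] by simp
    qed (use insert.prems in auto)
  qed
  finally show ?case using insert.hyps by simp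
qed

text \<open>Evenness implies centering, since \<open>exp a + exp (- a) \<ge> 2\<close> and the
  reflection preserves the measure.\<close>

lemma functional_santalo_even:
  fixes f g :: "'a::euclidean_space \<Rightarrow> ennreal"
  assumes B: "orthonormal B" and [measurable]: "f \<in> borel_measurable borel" "g \<in> borel_measurable borel"
    and even: "\<And>x. f (- x) = f x"
    and "\<And>x y. x \<in> span B \<Longrightarrow> y \<in> span B \<Longrightarrow> f x * g y \<le> ennreal (exp (- (x \<bullet> y)))"
  shows "(\<integral>\<^sup>+x. f x \<partial>span_measure B) * (\<integral>\<^sup>+x. g x \<partial>span_measure B) \<le> ennreal ((2 * pi) ^ card B)"
proof (rule functional_santalo_centered[OF assms(1-3) _ assms(5)])
  fix \<zeta> assume "\<zeta> \<in> span B"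
  let ?I = "\<integral>\<^sup>+x. f x * ennreal (exp (\<zeta> \<bullet> x)) \<partial>span_measure B"
  have "2 * (\<integral>\<^sup>+x. f x \<partial>span_measure B) = (\<integral>\<^sup>+x. 2 * f x \<partial>span_measure B)"
    by (simp add: nn_integral_cmult)
  also have "\<dots> \<le> (\<integral>\<^sup>+x. f x * ennreal (exp (\<zeta> \<bullet> x)) + f (- x) * ennreal (exp (\<zeta> \<bullet> (- x))) \<partial>span_measure B)"
  proof (rule nn_integral_mono)
    fix x
    let ?a = "\<zeta> \<bullet> x"
    have "2 \<le> exp ?a + exp (- ?a)"
      using exp_ge_add_one_self[of ?a] exp_ge_add_one_self[of "- ?a"] by linarith
    then have "ennreal 2 \<le> ennreal (exp ?a) + ennreal (exp (- ?a))"
      by (subst ennreal_plus[symmetric]) (auto intro: ennreal_leI simp del: ennreal_plus)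
    then have "f x * 2 \<le> f x * (ennreal (exp ?a) + ennreal (exp (- ?a)))"
      by (intro mult_left_mono) simp_all
    then show "2 * f x \<le> f x * ennreal (exp ?a) + f (- x) * ennreal (exp (\<zeta> \<bullet> (- x)))"
      by (simp add: even distrib_left mult.commute)
  qed
  also have "\<dots> = ?I + (\<integral>\<^sup>+x. f (- x) * ennreal (exp (\<zeta> \<bullet> (- x))) \<partial>span_measure B)"
    by (rule nn_integral_add) measurable
  also have "(\<integral>\<^sup>+x. f (- x) * ennreal (exp (\<zeta> \<bullet> (- x))) \<partial>span_measure B) = ?I"
    by (rule nn_integral_span_measure_uminus[OF B, of "\<lambda>x. f x * ennreal (exp (\<zeta> \<bullet> x))"]) measurable
  also have "?I + ?I = 2 * ?I" by (simp add: mult_2)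
  finally show "(\<integral>\<^sup>+x. f x \<partial>span_measure B) \<le> ?I"
    by (subst (asm) ennreal_mult_le_mult_iff) simp_all
qed

section \<open>The Gaussian Blaschke--Santalo inequality\<close>

text \<open>For positive \<open>u\<close> this is minus the derivative of the Gaussian, hence the
  weight that writes \<open>gauss\<close> as a mixture of indicators of balls.\<close>

definition rayleigh :: "real \<Rightarrow> ennreal" where
  "rayleigh u = ennreal u * gauss u"

lemma rayleigh_measurable [measurable]: "rayleigh \<in> borel_measurable borel"
  unfolding rayleigh_def by measurable

lemma nn_integral_rayleigh_tail:
  assumes "0 \<le> a"
  shows "(\<integral>\<^sup>+u. indicator {0<..} u * (rayleigh u * indicator {a..} u) \<partial>lborel) = ennreal (exp (- a\<^sup>2 / 2))"
proof -
  have "(\<integral>\<^sup>+u. indicator {0<..} u * (rayleigh u * indicator {a..} u) \<partial>lborel)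
    = (\<integral>\<^sup>+u. ennreal (u * exp (- u\<^sup>2 / 2)) * indicator {a..} u \<partial>lborel)"
    using assms by (intro nn_integral_cong) (auto simp: rayleigh_def gauss_def indicator_def ennreal_mult)
  also have "\<dots> = 0 - (- exp (- a\<^sup>2 / 2))"
  proof (rule nn_integral_FTC_atLeast[where F="\<lambda>u. - exp (- u\<^sup>2 / 2)"])
    show "((\<lambda>u::real. - exp (- u\<^sup>2 / 2)) \<longlongrightarrow> 0) at_top"
      by real_asymp
  qed (use assms in \<open>auto intro!: derivative_eq_intros\<close>)
  finally show ?thesis by simp
qed

lemma gauss_eq_nn_integral_rayleigh:
  "gauss x = (\<integral>\<^sup>+u. indicator {0<..} u * (rayleigh u * indicator {norm x..} u) \<partial>lborel)"
  using nn_integral_rayleigh_tail[of "norm x"] by (simp add: gauss_def)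

lemma gauss_mult_le:
  fixes s t :: real
  assumes "0 < s" "0 < t"
  shows "gauss s * gauss t \<le> (gauss (sqrt (s * t)))\<^sup>2"
proof -
  have "2 * (s * t) \<le> s\<^sup>2 + t\<^sup>2"
    using sum_squares_bound[of s t] by simp
  then have "exp (- s\<^sup>2 / 2) * exp (- t\<^sup>2 / 2) \<le> (exp (- (s * t) / 2))\<^sup>2"
    by (simp add: power2_eq_square[of "exp _"] flip: exp_add)
  then show ?thesis
    using assms by (simp add: gauss_def ennreal_power flip: ennreal_mult)
qed

lemma rayleigh_mult_le:
  assumes "0 < s" "0 < t"
  shows "rayleigh s * rayleigh t \<le> (rayleigh (sqrt (s * t)))\<^sup>2"
proof -
  have "rayleigh s * rayleigh t = ennreal (s * t) * (gauss s * gauss t)"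
    using assms by (simp add: rayleigh_def ennreal_mult ac_simps)
  also have "\<dots> \<le> ennreal (s * t) * (gauss (sqrt (s * t)))\<^sup>2"
    using assms by (intro mult_left_mono gauss_mult_le) simp_all
  also have "\<dots> = (rayleigh (sqrt (s * t)))\<^sup>2"
    using assms by (simp add: rayleigh_def power_mult_distrib ennreal_power)
  finally show ?thesis .
qed

lemma emeasure_span_measure_scale:
  assumes B: "orthonormal B" and "0 < r" and [measurable]: "E \<in> sets borel"
  shows "emeasure (span_measure B) {x. (1 / r) *\<^sub>R x \<in> E} = ennreal (r ^ card B) * emeasure (span_measure B) E"
proof -
  have "emeasure (span_measure B) {x. (1 / r) *\<^sub>R x \<in> E} = (\<integral>\<^sup>+x. indicator E ((1 / r) *\<^sub>R x) \<partial>span_measure B)"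
  proof -
    have "emeasure (span_measure B) {x. (1 / r) *\<^sub>R x \<in> E} = (\<integral>\<^sup>+x. indicator {x. (1 / r) *\<^sub>R x \<in> E} x \<partial>span_measure B)"
      by (rule nn_integral_indicator[symmetric]) measurable
    also have "\<dots> = (\<integral>\<^sup>+x. indicator E ((1 / r) *\<^sub>R x) \<partial>span_measure B)"
      by (intro nn_integral_cong) (simp add: indicator_def)
    finally show ?thesis .
  qed
  also have "\<dots> = ennreal (r ^ card B) * (\<integral>\<^sup>+x. indicator E ((1 / r) *\<^sub>R (r *\<^sub>R x)) \<partial>span_measure B)"
    using \<open>0 < r\<close> by (intro nn_integral_span_measure_scale[OF B]) measurable
  also have "(\<integral>\<^sup>+x. indicator E ((1 / r) *\<^sub>R (r *\<^sub>R x)) \<partial>span_measure B) = emeasure (span_measure B) E"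
    using \<open>0 < r\<close> by simp
  finally show ?thesis .
qed

text \<open>If \<open>E\<close> is a symmetric convex body, then \<open>body_gauss E x\<close> is \<open>exp (- N x^2 / 2)\<close> for the
  gauge \<open>N\<close> of \<open>E\<close>. The mixture form needs no convexity, and it is Borel by construction.\<close>

definition body_gauss :: "'a::euclidean_space set \<Rightarrow> 'a \<Rightarrow> ennreal" where
  "body_gauss E x = (\<integral>\<^sup>+r. indicator {0<..} r * (rayleigh r * indicator E ((1 / r) *\<^sub>R x)) \<partial>lborel)"

lemma body_gauss_measurable [measurable]:
  assumes [measurable]: "E \<in> sets borel"
  shows "body_gauss E \<in> borel_measurable borel"
  unfolding body_gauss_def by measurable

lemma sigma_finite_lborel_real: "sigma_finite_measure (lborel :: real measure)"
  by standard

text \<open>Dilation by \<open>r\<close> multiplies the measure of \<open>E\<close> by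
  \<open>r ^ card B\<close>, so the integral is proportional to that measure with a factor
  independent of \<open>E\<close>.\<close>

lemma nn_integral_body_gauss:
  assumes B: "orthonormal B" and [measurable]: "E \<in> sets borel"
  shows "(\<integral>\<^sup>+x. body_gauss E x \<partial>span_measure B)
    = (\<integral>\<^sup>+r. indicator {0<..} r * (rayleigh r * ennreal (r ^ card B)) \<partial>lborel) * emeasure (span_measure B) E"
proof -
  have "(\<integral>\<^sup>+x. body_gauss E x \<partial>span_measure B)
    = (\<integral>\<^sup>+r. (\<integral>\<^sup>+x. indicator {0<..} r * (rayleigh r * indicator E ((1 / r) *\<^sub>R x)) \<partial>span_measure B) \<partial>lborel)"
    unfolding body_gauss_def by (rule nn_integral_span_measure_swap[OF B sigma_finite_lborel_real]) measurable
  also have "\<dots> = (\<integral>\<^sup>+r. indicator {0<..} r * (rayleigh r * ennreal (r ^ card B)) * emeasure (span_measure B) E \<partial>lborel)"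
  proof (rule nn_integral_cong)
    fix r :: real
    have "(\<integral>\<^sup>+x. indicator {0<..} r * (rayleigh r * indicator E ((1 / r) *\<^sub>R x)) \<partial>span_measure B)
      = indicator {0<..} r * (rayleigh r * (\<integral>\<^sup>+x. indicator {x. (1 / r) *\<^sub>R x \<in> E} x \<partial>span_measure B))"
      by (simp add: nn_integral_cmult indicator_def of_bool_def)
    then show "(\<integral>\<^sup>+x. indicator {0<..} r * (rayleigh r * indicator E ((1 / r) *\<^sub>R x)) \<partial>span_measure B)
      = indicator {0<..} r * (rayleigh r * ennreal (r ^ card B)) * emeasure (span_measure B) E"
      using emeasure_span_measure_scale[OF B, of r E] by (cases "0 < r") (simp_all add: mult.assoc)
  qed
  finally show ?thesis
    by (simp add: nn_integral_multc)
qed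

lemma body_gauss_cball: "body_gauss (cball 0 1) x = gauss x"
proof -
  have "body_gauss (cball 0 1) x = (\<integral>\<^sup>+u. indicator {0<..} u * (rayleigh u * indicator {norm x..} u) \<partial>lborel)"
    unfolding body_gauss_def
    by (intro nn_integral_cong) (auto simp: indicator_def divide_simps)
  then show ?thesis by (simp add: gauss_eq_nn_integral_rayleigh)
qed

text \<open>If \<open>x\<close> lies in the dilate of \<open>A\<close> by \<open>s\<close> and
  \<open>y\<close> in that of \<open>C\<close> by \<open>t\<close>, then
  \<open>x \<bullet> y \<le> s * t\<close>. So only the Rayleigh tail beyond the square root of
  \<open>x \<bullet> y\<close> survives at the geometric mean, and its squared mass is the
  bound.\<close>

lemma body_gauss_mult_le:
  assumes [measurable]: "A \<in> sets borel" "C \<in> sets borel"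
    and le: "\<And>x y. x \<in> A \<Longrightarrow> y \<in> C \<Longrightarrow> x \<in> span B \<Longrightarrow> y \<in> span B \<Longrightarrow> x \<bullet> y \<le> 1"
    and xy: "x \<in> span B" "y \<in> span B"
  shows "body_gauss A x * body_gauss C y \<le> ennreal (exp (- (x \<bullet> y)))"
proof -
  \<comment> \<open>For a negative pairing the tail is the whole half-line and the bound 1 is still
    below \<open>exp (- (x \<bullet> y))\<close>.\<close>
  let ?p = "max 0 (x \<bullet> y)"
  have "body_gauss A x * body_gauss C y
    \<le> (\<integral>\<^sup>+u. indicator {0<..} u * (rayleigh u * indicator {sqrt ?p..} u) \<partial>lborel)\<^sup>2"
    unfolding body_gauss_def
  proof (rule prekopa_leindler_mult)
    fix s t :: real assume st: "0 < s" "0 < t"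
    show "rayleigh s * indicator A ((1 / s) *\<^sub>R x) * (rayleigh t * indicator C ((1 / t) *\<^sub>R y))
      \<le> (rayleigh (sqrt (s * t)) * indicator {sqrt ?p..} (sqrt (s * t)))\<^sup>2"
    proof (cases "(1 / s) *\<^sub>R x \<in> A \<and> (1 / t) *\<^sub>R y \<in> C")
      case True
      then have "((1 / s) *\<^sub>R x) \<bullet> ((1 / t) *\<^sub>R y) \<le> 1"
        using xy by (intro le span_scale) auto
      then have "?p \<le> s * t"
        using st by (simp add: field_simps)
      then show ?thesis
        using rayleigh_mult_le[OF st] True by (simp add: real_sqrt_le_mono)
    qed auto
  qed measurable
  also have "\<dots> = ennreal ((exp (- (sqrt ?p)\<^sup>2 / 2))\<^sup>2)"
    by (subst nn_integral_rayleigh_tail) (simp_all add: ennreal_power)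
  also have "(exp (- (sqrt ?p)\<^sup>2 / 2))\<^sup>2 = exp (- ?p)"
    by (simp add: power2_eq_square[of "exp _"] flip: exp_add)
  also have "ennreal (exp (- ?p)) \<le> ennreal (exp (- (x \<bullet> y)))"
    by (intro ennreal_leI) simp
  finally show ?thesis .
qed

section \<open>Blaschke--Santalo for sets\<close>

text \<open>The functional inequality for the two mixtures carries a factor \<open>c\<close> for
  each set. The unit ball, whose mixture is \<open>gauss\<close>, calibrates it: \<open>c\<close>
  times the measure of the ball squares to exactly the functional bound.\<close>

lemma blaschke_santalo_unit:
  fixes B :: "'a::euclidean_space set"
  assumes B: "orthonormal B" and [measurable]: "A \<in> sets borel" "C \<in> sets borel"
    and sym: "\<And>x. x \<in> A \<Longrightarrow> - x \<in> A"
    and le: "\<And>x y. x \<in> A \<Longrightarrow> y \<in> C \<Longrightarrow> x \<in> span B \<Longrightarrow> y \<in> span B \<Longrightarrow> x \<bullet> y \<le> 1"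
  shows "emeasure (span_measure B) A * emeasure (span_measure B) C \<le> (emeasure (span_measure B) (cball 0 1))\<^sup>2"
proof -
  let ?m = "emeasure (span_measure B)"
  define c where "c = (\<integral>\<^sup>+r. indicator {0<..} r * (rayleigh r * ennreal (r ^ card B)) \<partial>lborel)"
  have ball: "c * ?m (cball 0 1) = ennreal (sqrt (2 * pi) ^ card B)"
    using nn_integral_body_gauss[OF B, of "cball 0 1"] nn_integral_gauss_span[OF B]
    by (simp add: body_gauss_cball c_def)
  then have c: "c \<noteq> 0" "c \<noteq> top"
    by (auto simp: ennreal_top_mult split: if_splits)
  have "(\<integral>\<^sup>+x. body_gauss A x \<partial>span_measure B) * (\<integral>\<^sup>+x. body_gauss C x \<partial>span_measure B) \<le> ennreal ((2 * pi) ^ card B)"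
  proof (rule functional_santalo_even[OF B])
    have "- v \<in> A \<longleftrightarrow> v \<in> A" for v
      using sym[of v] sym[of "- v"] by auto
    then have "indicator A (- v) = (indicator A v :: ennreal)" for v
      by (simp add: indicator_def)
    then show "body_gauss A (- x) = body_gauss A x" for x
      by (simp add: body_gauss_def)
  qed (auto intro!: body_gauss_mult_le le)
  also have "(2 * pi) ^ card B = (sqrt (2 * pi) ^ card B)\<^sup>2"
  proof -
    have "(sqrt (2 * pi) ^ card B)\<^sup>2 = ((sqrt (2 * pi))\<^sup>2) ^ card B"
      by (simp only: power_mult[symmetric] mult.commute)
    then show ?thesis by simp
  qed
  also have "ennreal \<dots> = (c * ?m (cball 0 1))\<^sup>2"
    by (simp add: ball ennreal_power)
  finally have "(c * c) * (?m A * ?m C) \<le> (c * c) * (?m (cball 0 1))\<^sup>2"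
    unfolding nn_integral_body_gauss[OF B assms(2)] nn_integral_body_gauss[OF B assms(3)] c_def[symmetric]
    by (simp add: power2_eq_square ac_simps)
  then show ?thesis
    using c by (subst (asm) ennreal_mult_le_mult_iff) (simp_all add: ennreal_mult_eq_top_iff)
qed

text \<open>Only \<open>C\<close> is rescaled, so the symmetry of \<open>A\<close> is untouched; the
  factor \<open>c ^ card B\<close> is the square of the dilation factor of the ball.\<close>

lemma blaschke_santalo_pos:
  fixes B :: "'a::euclidean_space set"
  assumes B: "orthonormal B" and [measurable]: "A \<in> sets borel" "C \<in> sets borel"
    and sym: "\<And>x. x \<in> A \<Longrightarrow> - x \<in> A" and c: "0 < c"
    and le: "\<And>x y. x \<in> A \<Longrightarrow> y \<in> C \<Longrightarrow> x \<in> span B \<Longrightarrow> y \<in> span B \<Longrightarrow> x \<bullet> y \<le> c"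
  shows "emeasure (span_measure B) A * emeasure (span_measure B) C \<le> (emeasure (span_measure B) (cball 0 (sqrt c)))\<^sup>2"
proof -
  let ?m = "emeasure (span_measure B)"
  let ?C = "{y. c *\<^sub>R y \<in> C}"
  have "?m A * ?m ?C \<le> (?m (cball 0 1))\<^sup>2"
  proof (rule blaschke_santalo_unit[OF B _ _ sym])
    fix x y assume "x \<in> A" "y \<in> ?C" "x \<in> span B" "y \<in> span B"
    then have "x \<bullet> (c *\<^sub>R y) \<le> c"
      by (intro le) (auto intro: span_scale)
    then show "x \<bullet> y \<le> 1" using c by simp
  qed measurable
  then have "ennreal (c ^ card B) * (?m A * ?m ?C) \<le> ennreal (c ^ card B) * (?m (cball 0 1))\<^sup>2"
    by (rule mult_left_mono) simp
  moreover have "?m C = ennreal (c ^ card B) * ?m ?C"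
    using emeasure_span_measure_scale[OF B c, of ?C] c by simp
  moreover have "?m (cball 0 (sqrt c)) = ennreal (sqrt c ^ card B) * ?m (cball 0 1)"
  proof -
    have "{x. (1 / sqrt c) *\<^sub>R x \<in> cball 0 1} = (cball 0 (sqrt c) :: 'a set)"
      using c by (auto simp: field_simps)
    then show ?thesis
      using emeasure_span_measure_scale[OF B, of "sqrt c" "cball 0 1"] c by simp
  qed
  moreover have "(ennreal (sqrt c ^ card B))\<^sup>2 = ennreal (c ^ card B)"
  proof -
    have "(sqrt c ^ card B)\<^sup>2 = ((sqrt c)\<^sup>2) ^ card B"
      by (simp only: power_mult[symmetric] mult.commute)
    then show ?thesis using c by (simp add: ennreal_power)
  qed
  ultimately show ?thesis
    by (simp add: power_mult_distrib ac_simps)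
qed

text \<open>Rescaling is impossible for \<open>c = 0\<close>, so \<open>c\<close> is approached from
  above; balls have finite measure, so their measures converge to that of the intersection.\<close>

lemma blaschke_santalo:
  fixes B :: "'a::euclidean_space set"
  assumes B: "orthonormal B" and A: "A \<in> sets borel" and C: "C \<in> sets borel"
    and sym: "\<And>x. x \<in> A \<Longrightarrow> - x \<in> A" and c: "0 \<le> c"
    and le: "\<And>x y. x \<in> A \<Longrightarrow> y \<in> C \<Longrightarrow> x \<in> span B \<Longrightarrow> y \<in> span B \<Longrightarrow> x \<bullet> y \<le> c"
  shows "emeasure (span_measure B) A * emeasure (span_measure B) C \<le> (emeasure (span_measure B) (cball 0 (sqrt c)))\<^sup>2"
proof -
  let ?D = "\<lambda>n. cball (0::'a) (sqrt (c + 1 / real (Suc n)))"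
  have fin: "emeasure (span_measure B) (cball 0 r) \<noteq> \<infinity>" for r
    using emeasure_span_measure_cball_finite[OF B, of r] by auto
  have conv: "(\<lambda>n. sqrt (c + 1 / real (Suc n))) \<longlonglongrightarrow> sqrt c"
    using tendsto_real_sqrt[OF tendsto_add[OF tendsto_const LIMSEQ_Suc[OF lim_1_over_n]], of c] by simp
  have "(\<lambda>n. measure (span_measure B) (?D n)) \<longlonglongrightarrow> measure (span_measure B) (\<Inter>n. ?D n)"
  proof (rule Lim_measure_decseq)
    show "decseq ?D"
      unfolding decseq_def
      by (intro allI impI subset_cball real_sqrt_le_mono add_left_mono divide_left_mono) auto
  qed (use fin in auto)
  also have "(\<Inter>n. ?D n) = cball 0 (sqrt c)"
  proof (intro equalityI subsetI)
    fix x assume "x \<in> (\<Inter>n. ?D n)"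
    then have "norm x \<le> sqrt (c + 1 / real (Suc n))" for n
      by (auto simp del: of_nat_Suc)
    then show "x \<in> cball 0 (sqrt c)"
      using LIMSEQ_le_const[OF conv] by auto
  next
    fix x :: 'a assume "x \<in> cball 0 (sqrt c)"
    then show "x \<in> (\<Inter>n. ?D n)"
      by (auto intro: order_trans[OF _ real_sqrt_le_mono])
  qed
  finally have "(\<lambda>n. ennreal ((measure (span_measure B) (?D n))\<^sup>2)) \<longlonglongrightarrow> ennreal ((measure (span_measure B) (cball 0 (sqrt c)))\<^sup>2)"
    by (intro tendsto_ennrealI tendsto_power)
  then have lim: "(\<lambda>n. (emeasure (span_measure B) (?D n))\<^sup>2) \<longlonglongrightarrow> (emeasure (span_measure B) (cball 0 (sqrt c)))\<^sup>2"
    using fin by (simp add: emeasure_eq_ennreal_measure ennreal_power)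
  have "emeasure (span_measure B) A * emeasure (span_measure B) C \<le> (emeasure (span_measure B) (?D n))\<^sup>2" for n
  proof (rule blaschke_santalo_pos[OF B A C sym])
    show "x \<bullet> y \<le> c + 1 / real (Suc n)" if "x \<in> A" "y \<in> C" "x \<in> span B" "y \<in> span B" for x y
      using le[OF that] by (simp add: add_increasing2)
    show "0 < c + 1 / real (Suc n)"
      using c by (simp add: add_nonneg_pos)
  qed
  then show ?thesis
    by (intro LIMSEQ_le_const[OF lim]) auto
qed

section \<open>Passing from Lebesgue to Gaussian weights\<close>

lemma nn_integral_gauss_indicator_layers:
  assumes B: "orthonormal B" and [measurable]: "E \<in> sets borel"
  shows "(\<integral>\<^sup>+x. gauss x * indicator E x \<partial>span_measure B)
    = (\<integral>\<^sup>+r. indicator {0<..} r * (rayleigh r * emeasure (span_measure B) (E \<inter> cball 0 r)) \<partial>lborel)"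
proof -
  have "(\<integral>\<^sup>+x. gauss x * indicator E x \<partial>span_measure B)
    = (\<integral>\<^sup>+x. (\<integral>\<^sup>+r. indicator {0<..} r * (rayleigh r * indicator {norm x..} r) * indicator E x \<partial>lborel) \<partial>span_measure B)"
    by (subst gauss_eq_nn_integral_rayleigh) (simp add: nn_integral_multc)
  also have "\<dots> = (\<integral>\<^sup>+r. (\<integral>\<^sup>+x. indicator {0<..} r * (rayleigh r * indicator {norm x..} r) * indicator E x \<partial>span_measure B) \<partial>lborel)"
    by (rule nn_integral_span_measure_swap[OF B sigma_finite_lborel_real]) (simp add: indicator_def)
  also have "\<dots> = (\<integral>\<^sup>+r. indicator {0<..} r * (rayleigh r * emeasure (span_measure B) (E \<inter> cball 0 r)) \<partial>lborel)"
  proof (rule nn_integral_cong)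
    fix r :: real
    have [measurable]: "cball (0::'a) r \<in> sets borel" by simp
    have "(\<integral>\<^sup>+x. indicator {0<..} r * (rayleigh r * indicator {norm x..} r) * indicator E x \<partial>span_measure B)
      = (\<integral>\<^sup>+x. (indicator {0<..} r * rayleigh r) * indicator (E \<inter> cball 0 r) x \<partial>span_measure B)"
      by (intro nn_integral_cong) (auto simp: indicator_def)
    also have "\<dots> = (indicator {0<..} r * rayleigh r) * emeasure (span_measure B) (E \<inter> cball 0 r)"
      by (rule nn_integral_cmult_indicator) measurable
    finally show "(\<integral>\<^sup>+x. indicator {0<..} r * (rayleigh r * indicator {norm x..} r) * indicator E x \<partial>span_measure B)
      = indicator {0<..} r * (rayleigh r * emeasure (span_measure B) (E \<inter> cball 0 r))"
      by (simp add: mult.assoc)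
  qed
  finally show ?thesis .
qed

text \<open>Cutting by balls of radii \<open>s\<close> and \<open>t\<close> adds the Cauchy--Schwarz
  bound \<open>s * t\<close> to the bound \<open>c\<close>. The extremal ball for the smaller of the
  two bounds is the intersection of the balls with squared radii \<open>c\<close> and
  \<open>s * t\<close>, which is the layer of the right-hand side at
  \<open>sqrt (s * t)\<close>.\<close>

lemma gauss_santalo:
  fixes B :: "'a::euclidean_space set"
  assumes B: "orthonormal B" and [measurable]: "A \<in> sets borel" "C \<in> sets borel"
    and sym: "\<And>x. x \<in> A \<Longrightarrow> - x \<in> A" and c: "0 \<le> c"
    and le: "\<And>x y. x \<in> A \<Longrightarrow> y \<in> C \<Longrightarrow> x \<in> span B \<Longrightarrow> y \<in> span B \<Longrightarrow> x \<bullet> y \<le> c"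
  shows "(\<integral>\<^sup>+x. gauss x * indicator A x \<partial>span_measure B) * (\<integral>\<^sup>+x. gauss x * indicator C x \<partial>span_measure B)
    \<le> (\<integral>\<^sup>+x. gauss x * indicator (cball 0 (sqrt c)) x \<partial>span_measure B)\<^sup>2"
proof -
  let ?m = "emeasure (span_measure B)"
  have meas: "(\<lambda>r. ?m (E \<inter> cball 0 r)) \<in> borel_measurable borel" if [measurable]: "E \<in> sets borel" for E
  proof -
    interpret sigma_finite_measure "span_measure B" using sigma_finite_span_measure[OF B] .
    have [measurable]: "cball (0::'a) r \<in> sets borel" for r by simp
    have "?m (E \<inter> cball 0 r) = (\<integral>\<^sup>+x. indicator E x * indicator {norm x..} r \<partial>span_measure B)" for r
    proof -
      have "?m (E \<inter> cball 0 r) = (\<integral>\<^sup>+x. indicator (E \<inter> cball 0 r) x \<partial>span_measure B)"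
        by (rule nn_integral_indicator[symmetric]) measurable
      also have "\<dots> = (\<integral>\<^sup>+x. indicator E x * indicator {norm x..} r \<partial>span_measure B)"
        by (intro nn_integral_cong) (simp add: indicator_def)
      finally show ?thesis .
    qed
    moreover have "(\<lambda>r. \<integral>\<^sup>+x. indicator E x * indicator {norm x..} r \<partial>span_measure B) \<in> borel_measurable borel"
      by (rule borel_measurable_nn_integral) (simp add: indicator_def)
    ultimately show ?thesis by simp
  qed
  note [measurable] = meas
  have ball[measurable]: "cball (0::'a) r \<in> sets borel" for r by simp
  show ?thesis
    unfolding nn_integral_gauss_indicator_layers[OF B assms(2)] nn_integral_gauss_indicator_layers[OF B assms(3)]
      nn_integral_gauss_indicator_layers[OF B ball]
  proof (rule prekopa_leindler_mult)
    fix s t :: real assume st: "0 < s" "0 < t"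
    have "?m (A \<inter> cball 0 s) * ?m (C \<inter> cball 0 t) \<le> (?m (cball 0 (sqrt (min c (s * t)))))\<^sup>2"
    proof (rule blaschke_santalo[OF B])
      fix x y assume xy: "x \<in> A \<inter> cball 0 s" "y \<in> C \<inter> cball 0 t" "x \<in> span B" "y \<in> span B"
      have "x \<bullet> y \<le> norm x * norm y" by (rule norm_cauchy_schwarz)
      also have "\<dots> \<le> s * t" using xy st by (intro mult_mono) auto
      finally show "x \<bullet> y \<le> min c (s * t)" using le xy by auto
    qed (use sym c st in auto)
    also have "cball 0 (sqrt (min c (s * t))) = cball 0 (sqrt c) \<inter> (cball 0 (sqrt (s * t)) :: 'a set)"
      by (auto simp: min_def elim!: order_trans)
    finally have *: "?m (A \<inter> cball 0 s) * ?m (C \<inter> cball 0 t) \<le> (?m (cball 0 (sqrt c) \<inter> cball 0 (sqrt (s * t))))\<^sup>2" .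
    have "rayleigh s * ?m (A \<inter> cball 0 s) * (rayleigh t * ?m (C \<inter> cball 0 t))
      = (rayleigh s * rayleigh t) * (?m (A \<inter> cball 0 s) * ?m (C \<inter> cball 0 t))"
      by (simp add: ac_simps)
    also have "\<dots> \<le> (rayleigh (sqrt (s * t)))\<^sup>2 * (?m (cball 0 (sqrt c) \<inter> cball 0 (sqrt (s * t))))\<^sup>2"
      by (intro mult_mono rayleigh_mult_le st *) simp_all
    finally show "rayleigh s * ?m (A \<inter> cball 0 s) * (rayleigh t * ?m (C \<inter> cball 0 t))
      \<le> (rayleigh (sqrt (s * t)) * ?m (cball 0 (sqrt c) \<inter> cball 0 (sqrt (s * t))))\<^sup>2"
      by (simp add: power_mult_distrib)
  qed measurable
qed

section \<open>Slicing along the axis of symmetry\<close>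

text \<open>The set \<open>K0\<close> with its axis as a parameter, since the symmetry axis of
  \<open>K\<close> need not be a basis vector.\<close>

definition hyperboloid :: "'a::euclidean_space \<Rightarrow> 'a set" where
  "hyperboloid e = {z. 0 \<le> z \<bullet> e \<and> (norm (z - (z \<bullet> e) *\<^sub>R e))\<^sup>2 + 1 \<le> (z \<bullet> e)\<^sup>2}"

lemma hyperboloid_borel [measurable]: "hyperboloid e \<in> sets borel"
  unfolding hyperboloid_def by measurable

lemma nn_integral_gauss_slices:
  fixes B :: "'a::euclidean_space set"
  assumes B: "orthonormal (insert e B)" "e \<notin> B" and [measurable]: "E \<in> sets borel"
  shows "(\<integral>\<^sup>+x. gauss x * indicator E x \<partial>span_measure (insert e B))
    = (\<integral>\<^sup>+t. gauss t * (\<integral>\<^sup>+x. gauss x * indicator {x \<in> span B. x + t *\<^sub>R e \<in> E} x \<partial>span_measure B) \<partial>lborel)"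
proof -
  note e = orthonormal_insertD[OF B]
  have [measurable]: "span B \<in> sets borel" by (simp add: closed_span)
  have "(\<integral>\<^sup>+x. gauss x * indicator E x \<partial>span_measure (insert e B))
    = (\<integral>\<^sup>+x. (\<integral>\<^sup>+t. gauss (x + t *\<^sub>R e) * indicator E (x + t *\<^sub>R e) \<partial>lborel) \<partial>span_measure B)"
    by (rule nn_integral_span_measure_insert[OF orthonormal_finite[OF e(1)] B(2)]) measurable
  also have "\<dots> = (\<integral>\<^sup>+x. (\<integral>\<^sup>+t. gauss t * (gauss x * indicator {x \<in> span B. x + t *\<^sub>R e \<in> E} x) \<partial>lborel) \<partial>span_measure B)"
    using e by (intro nn_integral_span_measure_cong nn_integral_cong)
      (simp add: gauss_add_orthogonal_unit indicator_def ac_simps)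
  also have "\<dots> = (\<integral>\<^sup>+t. (\<integral>\<^sup>+x. gauss t * (gauss x * indicator {x \<in> span B. x + t *\<^sub>R e \<in> E} x) \<partial>span_measure B) \<partial>lborel)"
    by (rule nn_integral_span_measure_swap[OF e(1) sigma_finite_lborel_real]) (simp add: indicator_def)
  finally show ?thesis
    by (simp add: nn_integral_cmult)
qed

lemma hyperboloid_slice:
  assumes "x \<bullet> e = 0" "norm e = 1"
  shows "x + t *\<^sub>R e \<in> hyperboloid e \<longleftrightarrow> 0 \<le> t \<and> (norm x)\<^sup>2 + 1 \<le> t\<^sup>2"
  using assms by (simp add: hyperboloid_def inner_add_left norm_eq_1)

text \<open>At each height the slice is given by a condition on the norm alone, so its Gaussian
  integral depends only on the dimension of the orthogonal complement of the axis.\<close>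

lemma nn_integral_gauss_hyperboloid_eq:
  fixes B C :: "'a::euclidean_space set"
  assumes B: "orthonormal (insert e B)" "e \<notin> B" and C: "orthonormal (insert c C)" "c \<notin> C" and "card B = card C"
  shows "(\<integral>\<^sup>+x. gauss x * indicator (hyperboloid e) x \<partial>span_measure (insert e B))
    = (\<integral>\<^sup>+x. gauss x * indicator (hyperboloid c) x \<partial>span_measure (insert c C))"
proof -
  have slice: "(\<integral>\<^sup>+x. gauss x * indicator {x \<in> span D. x + t *\<^sub>R d \<in> hyperboloid d} x \<partial>span_measure D)
    = (\<integral>\<^sup>+x. ennreal (exp (- (norm x)\<^sup>2 / 2)) * indicator {\<rho>. 0 \<le> t \<and> \<rho>\<^sup>2 + 1 \<le> t\<^sup>2} (norm x) \<partial>span_measure D)"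
    if D: "orthonormal (insert d D)" "d \<notin> D" for d t and D :: "'a set"
    using orthonormal_insertD[OF D]
    by (intro nn_integral_span_measure_cong) (simp add: hyperboloid_slice indicator_def gauss_def)
  have "(\<integral>\<^sup>+x. ennreal (exp (- (norm x)\<^sup>2 / 2)) * indicator {\<rho>. 0 \<le> t \<and> \<rho>\<^sup>2 + 1 \<le> t\<^sup>2} (norm x) \<partial>span_measure B)
    = (\<integral>\<^sup>+x. ennreal (exp (- (norm x)\<^sup>2 / 2)) * indicator {\<rho>. 0 \<le> t \<and> \<rho>\<^sup>2 + 1 \<le> t\<^sup>2} (norm x) \<partial>span_measure C)" for t :: real
    using orthonormal_insertD(1)[OF B] orthonormal_insertD(1)[OF C] assms(5)
    by (rule nn_integral_span_measure_radial) measurable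
  then show ?thesis
    by (simp only: nn_integral_gauss_slices[OF B hyperboloid_borel] nn_integral_gauss_slices[OF C hyperboloid_borel]
        slice[OF B] slice[OF C])
qed

lemma gauss_polar_pair_le:
  fixes B :: "'a::euclidean_space set"
  assumes B: "orthonormal (insert e B)" "e \<notin> B"
    and K[measurable]: "K \<in> sets borel" and L[measurable]: "L \<in> sets borel"
    and sym: "\<And>x t. x \<bullet> e = 0 \<Longrightarrow> x + t *\<^sub>R e \<in> K \<Longrightarrow> - x + t *\<^sub>R e \<in> K"
    and pos: "\<And>x. x \<in> K \<Longrightarrow> 0 < x \<bullet> e" "\<And>y. y \<in> L \<Longrightarrow> 0 < y \<bullet> e"
    and polar: "\<And>x y. x \<in> K \<Longrightarrow> y \<in> L \<Longrightarrow> 1 \<le> x \<bullet> y"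
  shows "(\<integral>\<^sup>+x. gauss x * indicator K x \<partial>span_measure (insert e B)) * (\<integral>\<^sup>+x. gauss x * indicator L x \<partial>span_measure (insert e B))
    \<le> (\<integral>\<^sup>+x. gauss x * indicator (hyperboloid e) x \<partial>span_measure (insert e B))\<^sup>2"
proof -
  note e = orthonormal_insertD[OF B]
  have [measurable]: "span B \<in> sets borel" by (simp add: closed_span)
  interpret sigma_finite_measure "span_measure B" using sigma_finite_span_measure[OF e(1)] .
  define \<Phi> where "\<Phi> E t = (\<integral>\<^sup>+x. gauss x * indicator {x \<in> span B. x + t *\<^sub>R e \<in> E} x \<partial>span_measure B)" for E t
  have meas[measurable]: "\<Phi> E \<in> borel_measurable borel" if [measurable]: "E \<in> sets borel" for E
    unfolding \<Phi>_def by (intro borel_measurable_nn_integral) (simp add: indicator_def)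
  have slices: "(\<integral>\<^sup>+x. gauss x * indicator E x \<partial>span_measure (insert e B)) = (\<integral>\<^sup>+t. gauss t * \<Phi> E t \<partial>lborel)"
    if "E \<in> sets borel" for E
    unfolding \<Phi>_def by (rule nn_integral_gauss_slices[OF B that])
  have half: "(\<integral>\<^sup>+t. gauss t * \<Phi> E t \<partial>lborel) = (\<integral>\<^sup>+t. indicator {0<..} t * (gauss t * \<Phi> E t) \<partial>lborel)"
    if "\<And>x. x \<in> E \<Longrightarrow> 0 < x \<bullet> e" for E
  proof (rule nn_integral_cong)
    fix t :: real
    have "\<Phi> E t = 0" if "t \<le> 0"
    proof -
      have "{x \<in> span B. x + t *\<^sub>R e \<in> E} = {}"
        using \<open>\<And>x. x \<in> E \<Longrightarrow> 0 < x \<bullet> e\<close> e that by (force simp: inner_add_left)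
      then show ?thesis by (simp add: \<Phi>_def)
    qed
    then show "gauss t * \<Phi> E t = indicator {0<..} t * (gauss t * \<Phi> E t)"
      by (cases "0 < t") auto
  qed
  have hpos: "0 < x \<bullet> e" if "x \<in> hyperboloid e" for x
  proof -
    have "0 + 1 \<le> (norm (x - (x \<bullet> e) *\<^sub>R e))\<^sup>2 + 1"
      by (intro add_right_mono) simp
    also have "\<dots> \<le> (x \<bullet> e)\<^sup>2"
      using that by (simp add: hyperboloid_def)
    finally have "1 \<le> (x \<bullet> e)\<^sup>2" by simp
    then have "x \<bullet> e \<noteq> 0" by auto
    then show ?thesis using that by (auto simp: hyperboloid_def)
  qed
  have "(\<integral>\<^sup>+t. indicator {0<..} t * (gauss t * \<Phi> K t) \<partial>lborel) * (\<integral>\<^sup>+t. indicator {0<..} t * (gauss t * \<Phi> L t) \<partial>lborel)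
    \<le> (\<integral>\<^sup>+t. indicator {0<..} t * (gauss t * \<Phi> (hyperboloid e) t) \<partial>lborel)\<^sup>2"
  proof (rule prekopa_leindler_mult)
    fix s t :: real assume st: "0 < s" "0 < t"
    let ?A = "{x \<in> span B. x + s *\<^sub>R e \<in> K}" and ?C = "{y \<in> span B. y + t *\<^sub>R e \<in> L}"
    have bound: "x \<bullet> y \<le> s * t - 1" "- (x \<bullet> y) \<le> s * t - 1" if "x \<in> ?A" "y \<in> ?C" for x y
    proof -
      have x: "x \<bullet> e = 0" and y: "y \<bullet> e = 0" using that e by auto
      have "1 \<le> (x + s *\<^sub>R e) \<bullet> (y + t *\<^sub>R e)" "1 \<le> (- x + s *\<^sub>R e) \<bullet> (y + t *\<^sub>R e)"
        using that sym[OF x, of s] by (auto intro: polar)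
      then show "x \<bullet> y \<le> s * t - 1" "- (x \<bullet> y) \<le> s * t - 1"
        using x y e(3) by (simp_all add: inner_add_left inner_add_right inner_diff_left inner_diff_right inner_commute mult.commute)
    qed
    have "\<Phi> K s * \<Phi> L t \<le> (\<Phi> (hyperboloid e) (sqrt (s * t)))\<^sup>2"
    proof (cases "?A = {} \<or> ?C = {}")
      case True
      then show ?thesis by (auto simp: \<Phi>_def)
    next
      case False
      then obtain x y where "x \<in> ?A" "y \<in> ?C" by blast
      \<comment> \<open>Adding the two bounds: nonempty slices face each other only when
        \<open>s * t \<ge> 1\<close>, so the ball below has a real radius.\<close>
      from bound[OF this] have c: "0 \<le> s * t - 1" by linarith
      have "\<Phi> K s * \<Phi> L t \<le> (\<integral>\<^sup>+x. gauss x * indicator (cball 0 (sqrt (s * t - 1))) x \<partial>span_measure B)\<^sup>2"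
        unfolding \<Phi>_def
      proof (rule gauss_santalo[OF e(1) _ _ _ c])
        show "- x \<in> ?A" if "x \<in> ?A" for x
          using that sym[of x s] e(4) by (auto intro: span_neg)
      qed (use bound in auto)
      also have "(\<integral>\<^sup>+x. gauss x * indicator (cball 0 (sqrt (s * t - 1))) x \<partial>span_measure B) = \<Phi> (hyperboloid e) (sqrt (s * t))"
        unfolding \<Phi>_def
      proof (rule nn_integral_span_measure_cong)
        fix x assume x: "x \<in> span B"
        have "x + sqrt (s * t) *\<^sub>R e \<in> hyperboloid e \<longleftrightarrow> norm x \<le> sqrt (s * t - 1)"
        proof -
          have "norm x \<le> sqrt (s * t - 1) \<longleftrightarrow> (norm x)\<^sup>2 \<le> s * t - 1"
            using real_sqrt_le_iff[of "(norm x)\<^sup>2" "s * t - 1"] by simp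
          then show ?thesis
            using st e(2) e(4)[OF x] by (auto simp: hyperboloid_slice)
        qed
        then show "gauss x * indicator (cball 0 (sqrt (s * t - 1))) x
          = gauss x * indicator {x \<in> span B. x + sqrt (s * t) *\<^sub>R e \<in> hyperboloid e} x"
          using x by (simp add: indicator_def)
      qed
      finally show ?thesis .
    qed
    then have "(gauss s * gauss t) * (\<Phi> K s * \<Phi> L t) \<le> (gauss (sqrt (s * t)))\<^sup>2 * (\<Phi> (hyperboloid e) (sqrt (s * t)))\<^sup>2"
      by (intro mult_mono gauss_mult_le st) simp_all
    then show "gauss s * \<Phi> K s * (gauss t * \<Phi> L t) \<le> (gauss (sqrt (s * t)) * \<Phi> (hyperboloid e) (sqrt (s * t)))\<^sup>2"
      by (simp add: power_mult_distrib ac_simps)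
  qed measurable
  then show ?thesis
    by (simp only: slices[OF K] slices[OF L] slices[OF hyperboloid_borel] half[OF pos(1)] half[OF pos(2)] half[OF hpos])
qed

lemma orthonormal_extension:
  fixes e :: "'a::euclidean_space"
  assumes "norm e = 1"
  obtains B where "orthonormal (insert e B)" "e \<notin> B" "card B = DIM('a) - 1" "span_measure (insert e B) = lborel"
proof -
  let ?S = "{x. e \<bullet> x = 0}"
  obtain B where B: "B \<subseteq> ?S" "pairwise orthogonal B" "\<And>x. x \<in> B \<Longrightarrow> norm x = 1"
    "independent B" "card B = dim ?S" "span B = ?S"
    using orthonormal_basis_subspace[OF subspace_hyperplane[of e]] by metis
  have fin: "finite B" using B(4) by (rule independent_imp_finite)
  have ee: "e \<bullet> e = 1" using assms by (simp add: norm_eq_1)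
  have eB: "e \<notin> B" using B(1) ee by auto
  have on: "orthonormal (insert e B)"
    using B assms fin by (auto simp: orthonormal_def pairwise_insert orthogonal_def inner_commute)
  have "e \<noteq> 0" using assms by auto
  then have card: "card B = DIM('a) - 1"
    using B(5) by (simp add: dim_hyperplane)
  have "span (insert e B) = UNIV"
  proof -
    have "x \<in> span (insert e B)" for x
    proof -
      have "x - (x \<bullet> e) *\<^sub>R e \<in> span B"
        unfolding B(6) using ee by (simp add: inner_diff_right inner_commute)
      then show ?thesis by (auto simp: span_insert)
    qed
    then show ?thesis by auto
  qed
  then have "span_measure (insert e B) = lborel"
    using on eB fin card DIM_positive[where 'a='a] by (intro span_measure_eq_lborel) auto
  then show ?thesis using that on eB card by blast
qed

section \<open>The polarity and its compatibility with the reflection\<close>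

lemma closed_T_op: "closed (T_op K)"
proof -
  have "T_op K = (\<Inter>y\<in>K. {x. 1 \<le> x \<bullet> y})"
    by (auto simp: T_op_def)
  then show ?thesis
    by (auto intro!: closed_INT closed_Collect_le continuous_intros)
qed

lemma subset_T_op_T_op: "K \<subseteq> T_op (T_op K)"
  by (auto simp: T_op_def inner_commute)

text \<open>The reflection is self-adjoint: pairing a reflected point with \<open>y\<close> equals
  pairing the point with the reflection of \<open>y\<close>, which is again in
  \<open>K\<close>.\<close>

lemma T_op_symmetric:
  assumes K: "\<And>x t. x \<bullet> e = 0 \<Longrightarrow> x + t *\<^sub>R e \<in> K \<Longrightarrow> - x + t *\<^sub>R e \<in> K"
    and e: "norm e = 1" and x: "x \<bullet> e = 0" "x + t *\<^sub>R e \<in> T_op K"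
  shows "- x + t *\<^sub>R e \<in> T_op K"
  unfolding T_op_def
proof safe
  fix y assume y: "y \<in> K"
  let ?y = "y - (y \<bullet> e) *\<^sub>R e"
  have ee: "e \<bullet> e = 1" using e by (simp add: norm_eq_1)
  have "- ?y + (y \<bullet> e) *\<^sub>R e \<in> K"
    using y ee by (intro K) (simp_all add: inner_diff_left)
  then have "1 \<le> (x + t *\<^sub>R e) \<bullet> (- ?y + (y \<bullet> e) *\<^sub>R e)"
    using x(2) by (auto simp: T_op_def)
  then show "1 \<le> (- x + t *\<^sub>R e) \<bullet> y"
    using x(1) ee by (simp add: inner_add_left inner_add_right inner_diff_right inner_commute algebra_simps)
qed

text \<open>Averaging the polarity inequality over \<open>x\<close> and its reflection cancels the
  components orthogonal to \<open>e\<close>. Consequently the axial coordinates are nonzero and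
  share a sign.\<close>

lemma symmetric_polar_axis:
  assumes K: "\<And>x t. x \<bullet> e = 0 \<Longrightarrow> x + t *\<^sub>R e \<in> K \<Longrightarrow> - x + t *\<^sub>R e \<in> K"
    and e: "norm e = 1" and xy: "x \<in> K" "y \<in> T_op K"
  shows "1 \<le> (x \<bullet> e) * (y \<bullet> e)"
proof -
  let ?x = "x - (x \<bullet> e) *\<^sub>R e"
  have ee: "e \<bullet> e = 1" using e by (simp add: norm_eq_1)
  have "- ?x + (x \<bullet> e) *\<^sub>R e \<in> K"
    using xy ee by (intro K) (simp_all add: inner_diff_left)
  then have "1 \<le> y \<bullet> (- ?x + (x \<bullet> e) *\<^sub>R e)" "1 \<le> y \<bullet> x"
    using xy by (auto simp: T_op_def)
  then show ?thesis
    by (simp add: inner_add_right inner_diff_right inner_commute mult.commute)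
qed

lemma K0_eq_hyperboloid: "K0 = hyperboloid last_basis"
  by (simp add: K0_def hyperboloid_def Let_def)

lemma last_basis_in_Basis: "last_basis \<in> Basis"
  unfolding last_basis_def by (rule someI_ex) (use nonempty_Basis in blast)

section \<open>The Gaussian probability measure and the conclusion\<close>

lemma emeasure_gaussian_measure:
  fixes S :: "'a::euclidean_space set"
  assumes [measurable]: "S \<in> sets borel"
  shows "emeasure gaussian_measure S
    = ennreal ((2 * pi) powr (- real DIM('a) / 2)) * (\<integral>\<^sup>+x. gauss x * indicator S x \<partial>lborel)"
proof -
  have "emeasure gaussian_measure S
    = (\<integral>\<^sup>+x. ennreal ((2 * pi) powr (- real DIM('a) / 2) * exp (- (norm x)\<^sup>2 / 2)) * indicator S x \<partial>lborel)"
    unfolding gaussian_measure_def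
  proof (subst emeasure_density)
    show "(\<lambda>x::'a. ennreal ((2 * pi) powr (- real DIM('a) / 2) * exp (- (norm x)\<^sup>2 / 2))) \<in> borel_measurable lebesgue"
      by (rule measurable_completion) measurable
  qed (simp_all add: nn_integral_completion)
  also have "\<dots> = (\<integral>\<^sup>+x. ennreal ((2 * pi) powr (- real DIM('a) / 2)) * (gauss x * indicator S x) \<partial>lborel)"
    by (simp add: gauss_def ennreal_mult mult.assoc)
  also have "\<dots> = ennreal ((2 * pi) powr (- real DIM('a) / 2)) * (\<integral>\<^sup>+x. gauss x * indicator S x \<partial>lborel)"
    by (rule nn_integral_cmult) measurable
  finally show ?thesis .
qed

lemma finite_gaussian_measure: "finite_measure (gaussian_measure :: 'a::euclidean_space measure)"
proof (rule finite_measureI)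
  have "space gaussian_measure = (UNIV :: 'a set)"
    by (simp add: gaussian_measure_def)
  moreover have "(\<integral>\<^sup>+x. gauss (x :: 'a) \<partial>lborel) < \<infinity>"
    using nn_integral_gauss_span[OF orthonormal_Basis, where ?'a='a] by (simp add: span_measure_Basis)
  ultimately show "emeasure gaussian_measure (space (gaussian_measure :: 'a measure)) \<noteq> \<infinity>"
    using emeasure_gaussian_measure[of "UNIV :: 'a set"] by (simp add: ennreal_mult_eq_top_iff less_top)
qed

theorem theorem1p7:
  fixes K :: "'a::euclidean_space set" and e :: 'a
  assumes "K \<in> sets lebesgue"
    and "norm e = 1"
    and "\<And>x t. x \<bullet> e = 0 \<Longrightarrow> x + t *\<^sub>R e \<in> K \<Longrightarrow> - x + t *\<^sub>R e \<in> K"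
  shows "measure gaussian_measure K * measure gaussian_measure (T_op K)
           \<le> (measure gaussian_measure (K0 :: 'a set))\<^sup>2"
proof -
  let ?\<gamma> = "gaussian_measure :: 'a measure"
  interpret finite_measure ?\<gamma> by (rule finite_gaussian_measure)
  let ?L = "T_op K" and ?K = "T_op (T_op K)"
  let ?J = "\<lambda>S. \<integral>\<^sup>+x. gauss (x :: 'a) * indicator S x \<partial>lborel"
  have sets: "sets ?\<gamma> = sets lebesgue" by (simp add: gaussian_measure_def)
  have borel: "?L \<in> sets borel" "?K \<in> sets borel"
    by (simp_all add: closed_T_op)
  have symL: "- x + t *\<^sub>R e \<in> ?L" if "x \<bullet> e = 0" "x + t *\<^sub>R e \<in> ?L" for x t
    by (rule T_op_symmetric[OF assms(3,2) that])
  have symK: "- x + t *\<^sub>R e \<in> ?K" if "x \<bullet> e = 0" "x + t *\<^sub>R e \<in> ?K" for x t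
    by (rule T_op_symmetric[OF symL assms(2) that])
  have J: "?J ?K * ?J ?L \<le> (?J K0)\<^sup>2"
  proof (cases "?K = {} \<or> ?L = {}")
    case True
    then show ?thesis by auto
  next
    case False
    then obtain y0 where y0: "y0 \<in> ?L" by blast
    have axis: "1 \<le> (x \<bullet> e) * (y \<bullet> e)" if "x \<in> ?K" "y \<in> ?L" for x y
      using symmetric_polar_axis[OF symL assms(2) that(2,1)] by (simp add: mult.commute)
    \<comment> \<open>The axis is oriented by one point of \<open>?L\<close>; the sign rule in
      \<open>axis\<close> then makes all axial coordinates of both sets positive. The reflection is
      the same for \<open>e\<close> and \<open>- e\<close>.\<close>
    define u where "u = (if 0 < y0 \<bullet> e then e else - e)"
    have u: "norm u = 1" "u = e \<or> u = - e"
      using assms(2) by (auto simp: u_def)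
    have axis': "1 \<le> (x \<bullet> u) * (y \<bullet> u)" if "x \<in> ?K" "y \<in> ?L" for x y
      using axis[OF that] u(2) by auto
    have "y0 \<bullet> e \<noteq> 0"
      using False axis[OF _ y0] by fastforce
    then have y0u: "0 < y0 \<bullet> u"
      by (auto simp: u_def)
    have posK: "0 < x \<bullet> u" if "x \<in> ?K" for x
      using axis'[OF that y0] y0u by (smt (verit) mult_nonpos_nonneg)
    have posL: "0 < y \<bullet> u" if "y \<in> ?L" for y
      using False axis'[OF _ that] posK by (smt (verit) ex_in_conv mult_nonneg_nonpos)
    have symKu: "- x + t *\<^sub>R u \<in> ?K" if "x \<bullet> u = 0" "x + t *\<^sub>R u \<in> ?K" for x t
      using u(2)
    proof
      assume "u = e"
      then show ?thesis using symK[of x t] that by simp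
    next
      assume "u = - e"
      then show ?thesis using symK[of x "- t"] that by (simp del: add_uminus_conv_diff diff_conv_add_uminus)
    qed
    obtain B where B: "orthonormal (insert u B)" "u \<notin> B" "card B = DIM('a) - 1" "span_measure (insert u B) = lborel"
      using orthonormal_extension[OF u(1)] .
    let ?b = "last_basis :: 'a"
    let ?C = "Basis - {?b}"
    have C: "insert ?b ?C = Basis" "?b \<notin> ?C" "card ?C = DIM('a) - 1"
      using last_basis_in_Basis[where ?'a='a] by auto
    have "?J ?K * ?J ?L \<le> (?J (hyperboloid u))\<^sup>2"
      unfolding B(4)[symmetric]
    proof (rule gauss_polar_pair_le[OF B(1,2) borel(2,1) symKu posK posL])
      show "1 \<le> x \<bullet> y" if "x \<in> ?K" "y \<in> ?L" for x y
        using that by (simp add: T_op_def[of "T_op K"])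
    qed
    also have "?J (hyperboloid u) = ?J K0"
      using nn_integral_gauss_hyperboloid_eq[OF B(1,2), of ?b ?C] B C orthonormal_Basis[where ?'a='a]
      by (simp add: span_measure_Basis K0_eq_hyperboloid)
    finally show ?thesis .
  qed
  let ?c = "ennreal ((2 * pi) powr (- real DIM('a) / 2))"
  \<comment> \<open>\<open>K\<close> enters only through its inclusion in the closed set
    \<open>?K\<close>; the constant \<open>?c\<close> then occurs squared on both sides.\<close>
  have "emeasure ?\<gamma> K * emeasure ?\<gamma> ?L \<le> emeasure ?\<gamma> ?K * emeasure ?\<gamma> ?L"
    using borel by (intro mult_right_mono emeasure_mono subset_T_op_T_op) (auto simp: sets)
  also have "\<dots> = (?c * ?c) * (?J ?K * ?J ?L)"
    using borel by (simp only: emeasure_gaussian_measure ac_simps)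
  also have "\<dots> \<le> (?c * ?c) * (?J K0)\<^sup>2"
    by (intro mult_left_mono J) simp
  also have "\<dots> = (emeasure ?\<gamma> K0)\<^sup>2"
    by (simp only: K0_eq_hyperboloid emeasure_gaussian_measure[OF hyperboloid_borel] power2_eq_square ac_simps)
  finally have "ennreal (measure ?\<gamma> K * measure ?\<gamma> ?L) \<le> ennreal ((measure ?\<gamma> K0)\<^sup>2)"
    by (simp add: emeasure_eq_measure ennreal_mult ennreal_power)
  then show ?thesis
    by (simp add: ennreal_le_iff)
qed

end
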